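(* Let $p$ be a prime with $5\le p\le 19$ and let $x_1,\dots,x_{(p-1)/2}$ be the level-$p$ functions listed in the context. For every $\gamma\in\Gamma_0(p)$ and every $i$, $\langle\gamma\rangle(x_i)=\pm x_j$ for some $j$ (i.e. $\Gamma_0(p)$ permutes the $x_i$ up to change of sign under the action $\langle\cdot\rangle$), and the resulting permutation representation is isomorphic to $(\mathbb Z/p\mathbb Z)^*/\{\pm1\}$.
   Context: $\tau$ lies in the upper half plane, $q=e^{2\pi i\tau}$, $(a;q)_\infty=\prod_{j\ge0}(1-aq^j)$, $(a_1,\dots,a_r;q)_\infty=\prod_i(a_i;q)_\infty$. $\Gamma_0(p)=\{\gamma=\begin{pmatrix}\gamma_{11}&\gamma_{12}\\\gamma_{21}&\gamma_{22}\end{pmatrix}\in SL(2,\mathbb Z):\gamma_{21}\equiv0\pmod p\}$ (taken modulo $\pm I$), and for a weight-$k$ form $f$ on $\Gamma_1(p)$, $\langle\gamma\rangle(f)(\tau)=(\gamma_{21}\tau+\gamma_{22})^{-k}f(\gamma\tau)$ with $\gamma\tau=(\gamma_{11}\tau+\gamma_{12})/(\gamma_{21}\tau+\gamma_{22})$; here all $x_i$ have weight $1$. The functions are: $p=5$: $\frac{(q;q)_\infty^2}{(q,q^4;q^5)_\infty^5}$, $q\frac{(q;q)_\infty^2}{(q^2,q^3;q^5)_\infty^5}$. $p=7$: $\frac{(q^3,q^4,q^7,q^7;q^7)_\infty}{(q,q^6;q^7)_\infty^2}$, $q\frac{(q^2,q^5,q^7,q^7;q^7)_\infty}{(q^3,q^4;q^7)_\infty^2}$,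 $-q\frac{(q,q^6,q^7,q^7;q^7)_\infty}{(q^2,q^5;q^7)_\infty^2}$. $p=11$: $\frac{(q^4,q^7,q^{11},q^{11};q^{11})_\infty}{(q,q^{10},q^2,q^9;q^{11})_\infty}$, $q\frac{(q^5,q^6,q^{11},q^{11};q^{11})_\infty}{(q^3,q^8,q^4,q^7;q^{11})_\infty}$, $q^2\frac{(q,q^{10},q^{11},q^{11};q^{11})_\infty}{(q^3,q^8,q^5,q^6;q^{11})_\infty}$, $q\frac{(q^3,q^8,q^{11},q^{11};q^{11})_\infty}{(q^2,q^9,q^4,q^7;q^{11})_\infty}$, $q\frac{(q^2,q^9,q^{11},q^{11};q^{11})_\infty}{(q^5,q^6,q,q^{10};q^{11})_\infty}$. $p=13$: $\frac{(q^6,q^7,q^{13},q^{13};q^{13})_\infty}{(q,q^{12},q^3,q^{10};q^{13})_\infty}$, $q\frac{(q^5,q^8,q^{13},q^{13};q^{13})_\infty}{(q^3,q^{10},q^4,q^9;q^{13})_\infty}$, $q\frac{(q^2,q^{11},q^{13},q^{13};q^{13})_\infty}{(q,q^{12},q^4,q^9;q^{13})_\infty}$, $q\frac{(q^4,q^9,q^{13},q^{13};q^{13})_\infty}{(q^2,q^{11},q^5,q^8;q^{13})_\infty}$, $q^2\frac{(q^3,q^{10},q^{13},q^{13};q^{13})_\infty}{(q^5,q^8,q^6,q^7;q^{13})_\infty}$, $q^2\frac{(q,q^{12},q^{13},q^{13};q^{13})_\infty}{(q^2,q^{11},q^6,q^7;q^{13})_\infty}$. $p=17$: $\frac{(q^8,q^9,q^{17},q^{17};q^{17})_\infty}{(q^2,q^{15},q^3,q^{14};q^{17})_\infty}$,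 $q\frac{(q^5,q^{12},q^{17},q^{17};q^{17})_\infty}{(q^3,q^{14},q^4,q^{13};q^{17})_\infty}$, $q^3\frac{(q,q^{16},q^{17},q^{17};q^{17})_\infty}{(q^4,q^{13},q^6,q^{11};q^{17})_\infty}$, $q^2\frac{(q^7,q^{10},q^{17},q^{17};q^{17})_\infty}{(q^6,q^{11},q^8,q^9;q^{17})_\infty}$, $q^3\frac{(q^2,q^{15},q^{17},q^{17};q^{17})_\infty}{(q^5,q^{12},q^8,q^9;q^{17})_\infty}$, $q\frac{(q^3,q^{14},q^{17},q^{17};q^{17})_\infty}{(q,q^{16},q^5,q^{12};q^{17})_\infty}$, $q\frac{(q^4,q^{13},q^{17},q^{17};q^{17})_\infty}{(q,q^{16},q^7,q^{10};q^{17})_\infty}$, $q\frac{(q^6,q^{11},q^{17},q^{17};q^{17})_\infty}{(q^2,q^{15},q^7,q^{10};q^{17})_\infty}$. $p=19$: $\frac{(q^8,q^{11},q^9,q^{10},q^{19},q^{19};q^{19})_\infty}{(q^3,q^{16},q^4,q^{15},q^5,q^{14};q^{19})_\infty}$, $q\frac{(q^2,q^{17},q^7,q^{12},q^{19},q^{19};q^{19})_\infty}{(q,q^{18},q^4,q^{15},q^6,q^{13};q^{19})_\infty}$, $q\frac{(q^3,q^{16},q^9,q^{10},q^{19},q^{19};q^{19})_\infty}{(q,q^{18},q^5,q^{14},q^8,q^{11};q^{19})_\infty}$, $q\frac{(q^4,q^{15},q^7,q^{12},q^{19},q^{19};q^{19})_\infty}{(q^2,q^{17},q^5,q^{14},q^6,q^{13};q^{19})_\infty}$,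 $q^5\frac{(q,q^{18},q^3,q^{16},q^{19},q^{19};q^{19})_\infty}{(q^6,q^{13},q^8,q^{11},q^9,q^{10};q^{19})_\infty}$, $q^2\frac{(q^4,q^{15},q^5,q^{14},q^{19},q^{19};q^{19})_\infty}{(q^2,q^{17},q^7,q^{12},q^8,q^{11};q^{19})_\infty}$, $q^2\frac{(q,q^{18},q^6,q^{13},q^{19},q^{19};q^{19})_\infty}{(q^2,q^{17},q^3,q^{16},q^9,q^{10};q^{19})_\infty}$, $q^2\frac{(q^5,q^{14},q^8,q^{11},q^{19},q^{19};q^{19})_\infty}{(q^4,q^{15},q^7,q^{12},q^9,q^{10};q^{19})_\infty}$, $q\frac{(q^2,q^{17},q^6,q^{13},q^{19},q^{19};q^{19})_\infty}{(q,q^{18},q^3,q^{16},q^7,q^{12};q^{19})_\infty}$. *)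

theory Defs
  imports "HOL-Analysis.Analysis" "HOL-Algebra.Sym_Groups" "HOL-Number_Theory.Residues"
begin

definition qpoch :: "complex list \<Rightarrow> complex \<Rightarrow> complex"
  where "qpoch as q = (\<Prod>a\<leftarrow>as. \<Prod>j. 1 - a * q ^ j)"

definition upper_half_plane :: "complex set"
  where "upper_half_plane = {\<tau>. Im \<tau> > 0}"

definition level_fns :: "nat \<Rightarrow> complex \<Rightarrow> complex list" where
  "level_fns p q =
    (if p = 5 then
       [qpoch [q] q ^ 2 / qpoch [q, q^4] (q^5) ^ 5,
        q * qpoch [q] q ^ 2 / qpoch [q^2, q^3] (q^5) ^ 5]
     else if p = 7 then
       [qpoch [q^3, q^4, q^7, q^7] (q^7) / qpoch [q, q^6] (q^7) ^ 2,
        q * qpoch [q^2, q^5, q^7, q^7] (q^7) / qpoch [q^3, q^4] (q^7) ^ 2,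
        -q * qpoch [q, q^6, q^7, q^7] (q^7) / qpoch [q^2, q^5] (q^7) ^ 2]
     else if p = 11 then
       [qpoch [q^4, q^7, q^11, q^11] (q^11) / qpoch [q, q^10, q^2, q^9] (q^11),
        q * qpoch [q^5, q^6, q^11, q^11] (q^11) / qpoch [q^3, q^8, q^4, q^7] (q^11),
        q^2 * qpoch [q, q^10, q^11, q^11] (q^11) / qpoch [q^3, q^8, q^5, q^6] (q^11),
        q * qpoch [q^3, q^8, q^11, q^11] (q^11) / qpoch [q^2, q^9, q^4, q^7] (q^11),
        q * qpoch [q^2, q^9, q^11, q^11] (q^11) / qpoch [q^5, q^6, q, q^10] (q^11)]
     else if p = 13 then
       [qpoch [q^6, q^7, q^13, q^13] (q^13) / qpoch [q, q^12, q^3, q^10] (q^13),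
        q * qpoch [q^5, q^8, q^13, q^13] (q^13) / qpoch [q^3, q^10, q^4, q^9] (q^13),
        q * qpoch [q^2, q^11, q^13, q^13] (q^13) / qpoch [q, q^12, q^4, q^9] (q^13),
        q * qpoch [q^4, q^9, q^13, q^13] (q^13) / qpoch [q^2, q^11, q^5, q^8] (q^13),
        q^2 * qpoch [q^3, q^10, q^13, q^13] (q^13) / qpoch [q^5, q^8, q^6, q^7] (q^13),
        q^2 * qpoch [q, q^12, q^13, q^13] (q^13) / qpoch [q^2, q^11, q^6, q^7] (q^13)]
     else if p = 17 then
       [qpoch [q^8, q^9, q^17, q^17] (q^17) / qpoch [q^2, q^15, q^3, q^14] (q^17),
        q * qpoch [q^5, q^12, q^17, q^17] (q^17) / qpoch [q^3, q^14, q^4, q^13] (q^17),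
        q^3 * qpoch [q, q^16, q^17, q^17] (q^17) / qpoch [q^4, q^13, q^6, q^11] (q^17),
        q^2 * qpoch [q^7, q^10, q^17, q^17] (q^17) / qpoch [q^6, q^11, q^8, q^9] (q^17),
        q^3 * qpoch [q^2, q^15, q^17, q^17] (q^17) / qpoch [q^5, q^12, q^8, q^9] (q^17),
        q * qpoch [q^3, q^14, q^17, q^17] (q^17) / qpoch [q, q^16, q^5, q^12] (q^17),
        q * qpoch [q^4, q^13, q^17, q^17] (q^17) / qpoch [q, q^16, q^7, q^10] (q^17),
        q * qpoch [q^6, q^11, q^17, q^17] (q^17) / qpoch [q^2, q^15, q^7, q^10] (q^17)]
     else if p = 19 then
       [qpoch [q^8, q^11, q^9, q^10, q^19, q^19] (q^19) / qpoch [q^3, q^16, q^4, q^15, q^5, q^14] (q^19),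
        q * qpoch [q^2, q^17, q^7, q^12, q^19, q^19] (q^19) / qpoch [q, q^18, q^4, q^15, q^6, q^13] (q^19),
        q * qpoch [q^3, q^16, q^9, q^10, q^19, q^19] (q^19) / qpoch [q, q^18, q^5, q^14, q^8, q^11] (q^19),
        q * qpoch [q^4, q^15, q^7, q^12, q^19, q^19] (q^19) / qpoch [q^2, q^17, q^5, q^14, q^6, q^13] (q^19),
        q^5 * qpoch [q, q^18, q^3, q^16, q^19, q^19] (q^19) / qpoch [q^6, q^13, q^8, q^11, q^9, q^10] (q^19),
        q^2 * qpoch [q^4, q^15, q^5, q^14, q^19, q^19] (q^19) / qpoch [q^2, q^17, q^7, q^12, q^8, q^11] (q^19),
        q^2 * qpoch [q, q^18, q^6, q^13, q^19, q^19] (q^19) / qpoch [q^2, q^17, q^3, q^16, q^9, q^10] (q^19),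
        q^2 * qpoch [q^5, q^14, q^8, q^11, q^19, q^19] (q^19) / qpoch [q^4, q^15, q^7, q^12, q^9, q^10] (q^19),
        q * qpoch [q^2, q^17, q^6, q^13, q^19, q^19] (q^19) / qpoch [q, q^18, q^3, q^16, q^7, q^12] (q^19)]
     else [])"

text \<open>The indices \<open>i\<close> run from \<open>1\<close> to \<open>(p - 1) / 2\<close>.\<close>

definition xfun :: "nat \<Rightarrow> nat \<Rightarrow> complex \<Rightarrow> complex"
  where "xfun p i \<tau> = level_fns p (exp (2 * of_real pi * \<i> * \<tau>)) ! (i - 1)"

definition moebius :: "int^2^2 \<Rightarrow> complex \<Rightarrow> complex" where
  "moebius \<gamma> \<tau> =
     (of_int (\<gamma> $ 1 $ 1) * \<tau> + of_int (\<gamma> $ 1 $ 2)) /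
     (of_int (\<gamma> $ 2 $ 1) * \<tau> + of_int (\<gamma> $ 2 $ 2))"

definition diamond :: "int \<Rightarrow> int^2^2 \<Rightarrow> (complex \<Rightarrow> complex) \<Rightarrow> complex \<Rightarrow> complex" where
  "diamond k \<gamma> f \<tau> =
     (of_int (\<gamma> $ 2 $ 1) * \<tau> + of_int (\<gamma> $ 2 $ 2)) powi (- k) * f (moebius \<gamma> \<tau>)"

definition eq_upto_sign :: "(complex \<Rightarrow> complex) \<Rightarrow> (complex \<Rightarrow> complex) \<Rightarrow> bool" where
  "eq_upto_sign f g \<longleftrightarrow>
     (\<forall>\<tau>\<in>upper_half_plane. f \<tau> = g \<tau>) \<or> (\<forall>\<tau>\<in>upper_half_plane. f \<tau> = - g \<tau>)"

definition Gamma0 :: "nat \<Rightarrow> (int^2^2) monoid" where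
  "Gamma0 p = \<lparr>carrier = {\<gamma>. det \<gamma> = 1 \<and> [\<gamma> $ 2 $ 1 = 0] (mod int p)}, mult = (**), one = mat 1\<rparr>"

definition pm_I :: "(int^2^2) set"
  where "pm_I = {mat 1, - mat 1}"

definition PGamma0 :: "nat \<Rightarrow> (int^2^2) set monoid"
  where "PGamma0 p = Gamma0 p Mod pm_I"

definition units_mod_pm :: "nat \<Rightarrow> int set monoid"
  where "units_mod_pm p = units_of (residue_ring (int p)) Mod {1, int p - 1}"

definition unit_class :: "nat \<Rightarrow> int \<Rightarrow> int set"
  where "unit_class p d = {1, int p - 1} #>\<^bsub>units_of (residue_ring (int p))\<^esub> (d mod int p)"

text \<open>
  The permutation of the indices induced by an element \<open>C\<close> of \<open>PGamma0 p\<close>, i.e. by a class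
  \<open>{\<gamma>, -\<gamma>}\<close>. The description is meaningful only if the index \<open>j\<close> exists and is unique.
  Since \<open>f \<mapsto> diamond k \<gamma> f\<close> is a right action,
  \<open>perm_rep p\<close> is a priori an anti-homomorphism for composition of permutations; for these
  functions the induced permutations commute, so that it is a homomorphism as well.
\<close>

definition perm_rep :: "nat \<Rightarrow> (int^2^2) set \<Rightarrow> nat \<Rightarrow> nat" where
  "perm_rep p C i =
     (if i \<in> {1..(p - 1) div 2}
      then THE j. j \<in> {1..(p - 1) div 2} \<and>
                  (\<forall>\<gamma>\<in>C. eq_upto_sign (diamond 1 \<gamma> (xfun p i)) (xfun p j))
      else i)"

end

theory Submission
  imports Defs "HOL-Complex_Analysis.Complex_Singularities" "HOL-Real_Asymp.Real_Asymp"
begin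

text \<open>
  Put \<open>K\<^sub>g(\<tau>) = exp (\<pi> \<i> g\<^sup>2 \<tau> / p) \<theta>\<^sub>1(g \<tau> | p \<tau>) / \<theta>\<^sub>1'(0 | p \<tau>)\<close>. Each \<open>x\<^sub>i\<close> is, up to sign, a constant
  times a product of functions \<open>K\<^sub>g\<close> with one more factor in the denominator than in the numerator, and all
  the \<open>x\<^sub>i\<close> arise from \<open>x\<^sub>1\<close> by multiplying the indices \<open>g\<close> by units \<open>u\<^sub>i\<close>. The quotient
  \<open>\<theta>\<^sub>1(z | \<tau>) / \<theta>\<^sub>1'(0 | \<tau>)\<close> is a Jacobi form of weight \<open>-1\<close> without multiplier: after a modular substitution
  its ratio to the original is elliptic and entire, hence constant by Liouville's theorem, and the derivative
  at \<open>0\<close> gives the constant. Therefore \<open>\<gamma>\<close> in \<open>\<Gamma>\<^sub>0(p)\<close> maps \<open>K\<^sub>g\<close> to \<open>K\<^sub>a\<^sub>g\<close>, where \<open>a\<close> is the upper left entry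
  of \<open>\<gamma>\<close>, times a root of unity and the weight factor; since the signed sum of the \<open>g\<^sup>2\<close> vanishes modulo \<open>p\<close>, the
  roots of unity multiply up to a sign. As \<open>K\<^sub>g\<close> depends on \<open>g\<close> only modulo \<open>p\<close> and up to sign,
  \<open>\<Gamma>\<^sub>0(p)\<close> acts through the units modulo \<open>\<plusminus>1\<close>. The action is free because \<open>x\<^sub>1\<close> is the only
  \<open>x\<^sub>i\<close> that does not vanish at \<open>q = 0\<close>.
\<close>

section \<open>The infinite product and the normalised theta function\<close>

definition qprod :: "complex \<Rightarrow> complex \<Rightarrow> complex"
  where "qprod w q = (\<Prod>j. 1 - w * q ^ j)"

lemma qpoch_Nil [simp]: "qpoch [] q = 1"
  by (simp add: qpoch_def)

lemma qpoch_Cons [simp]: "qpoch (a # as) q = qprod a q * qpoch as q"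
  by (simp add: qpoch_def qprod_def)

lemma summable_norm_geometric_mult:
  fixes w q :: complex
  assumes "norm q < 1"
  shows "summable (\<lambda>j. norm (w * q ^ j))"
  using assms by (auto simp: norm_mult norm_power intro!: summable_mult summable_geometric)

lemma convergent_qprod:
  fixes w q :: complex
  assumes "norm q < 1"
  shows "convergent_prod (\<lambda>j. 1 - w * q ^ j)"
proof -
  have "abs_convergent_prod (\<lambda>j. 1 - w * q ^ j)"
    using summable_norm_geometric_mult[OF assms, of w]
    by (simp add: abs_convergent_prod_conv_summable norm_minus_commute)
  then show ?thesis
    by (rule abs_convergent_prod_imp_convergent_prod)
qed

lemma has_prod_qprod:
  assumes "norm q < 1"
  shows "(\<lambda>j. 1 - w * q ^ j) has_prod qprod w q"
  unfolding qprod_def using convergent_qprod[OF assms] by (rule convergent_prod_has_prod)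

lemma tendsto_qprod:
  assumes "norm q < 1"
  shows "(\<lambda>n. \<Prod>j<n. 1 - w * q ^ j) \<longlonglongrightarrow> qprod w q"
  using has_prod_imp_tendsto'[OF has_prod_qprod[OF assms]] .

lemma qprod_eq_0_iff:
  assumes "norm q < 1"
  shows "qprod w q = 0 \<longleftrightarrow> (\<exists>j. w * q ^ j = 1)"
  unfolding has_prod_eq_0_iff[OF has_prod_qprod[OF assms]] by (auto simp: image_iff)

lemma qprod_rec:
  assumes "norm q < 1"
  shows "qprod w q = (1 - w) * qprod (w * q) q"
proof (rule LIMSEQ_unique)
  show "(\<lambda>n. \<Prod>j<Suc n. 1 - w * q ^ j) \<longlonglongrightarrow> qprod w q"
    using tendsto_qprod[OF assms] by (rule LIMSEQ_Suc)
  have "(\<lambda>n. (1 - w) * (\<Prod>j<n. 1 - (w * q) * q ^ j)) \<longlonglongrightarrow> (1 - w) * qprod (w * q) q"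
    by (intro tendsto_intros tendsto_qprod assms)
  then show "(\<lambda>n. \<Prod>j<Suc n. 1 - w * q ^ j) \<longlonglongrightarrow> (1 - w) * qprod (w * q) q"
    by (simp add: prod.lessThan_Suc_shift mult.assoc del: prod.lessThan_Suc)
qed

lemma holomorphic_qprod:
  assumes q: "norm q < 1"
  shows "(\<lambda>w. qprod w q) holomorphic_on UNIV"
proof (rule holomorphic_uniform_sequence)
  show "(\<lambda>w. \<Prod>j<n. 1 - w * q ^ j) holomorphic_on UNIV" for n
    by (intro holomorphic_intros)
  fix x :: complex
  let ?K = "cball x 1"
  \<comment> \<open>On the closed unit ball about \<open>x\<close> the bound
    \<open>norm w \<le> norm x + 1\<close> gives a geometric majorant independent of
    \<open>w\<close>, and uniform convergence passes from the sum of
    \<open>norm (factor - 1)\<close> to the product.\<close>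
  have "uniformly_convergent_on ?K (\<lambda>N w. \<Sum>n<N. norm ((1 - w * q ^ n) - 1))"
  proof (rule Weierstrass_m_test')
    show "summable (\<lambda>n. norm (of_real (norm x + 1) * q ^ n))"
      by (rule summable_norm_geometric_mult[OF q])
    fix n w assume "w \<in> ?K"
    then have "norm w \<le> norm x + 1"
      using norm_triangle_sub[of w x] by (simp add: dist_norm norm_minus_commute)
    then show "norm (norm (1 - w * q ^ n - 1)) \<le> norm (of_real (norm x + 1) * q ^ n)"
      by (simp add: norm_mult norm_power mult_right_mono)
  qed
  then have "uniformly_convergent_on ?K (\<lambda>N w. \<Prod>n<N. 1 - w * q ^ n)"
    by (intro uniformly_convergent_on_prod' continuous_intros) auto
  then obtain l where l: "uniform_limit ?K (\<lambda>N w. \<Prod>n<N. 1 - w * q ^ n) l sequentially"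
    by (auto simp: uniformly_convergent_on_def)
  have "l w = qprod w q" if "w \<in> ?K" for w
    using tendsto_uniform_limitI[OF l that] tendsto_qprod[OF q] LIMSEQ_unique by blast
  then have "uniform_limit ?K (\<lambda>N w. \<Prod>n<N. 1 - w * q ^ n) (\<lambda>w. qprod w q) sequentially"
    using l by (metis (no_types, lifting) uniform_limit_cong')
  then show "\<exists>d>0. cball x d \<subseteq> UNIV \<and>
      uniform_limit (cball x d) (\<lambda>n w. \<Prod>j<n. 1 - w * q ^ j) (\<lambda>w. qprod w q) sequentially"
    by (intro exI[of _ 1]) auto
qed auto

lemma holomorphic_on_qprod [holomorphic_intros]:
  assumes "f holomorphic_on S" "norm q < 1"
  shows "(\<lambda>z. qprod (f z) q) holomorphic_on S"
  using holomorphic_on_compose_gen[OF assms(1) holomorphic_qprod[OF assms(2)]]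
  by (simp add: o_def)

section \<open>The exponential and the quasi-periodicity, zeros and derivative of the theta
  function\<close>

definition cis2pi :: "complex \<Rightarrow> complex"
  where "cis2pi z = exp (2 * of_real pi * \<i> * z)"

lemma cis2pi_nonzero [simp]: "cis2pi z \<noteq> 0"
  by (simp add: cis2pi_def)

lemma cis2pi_add: "cis2pi (x + y) = cis2pi x * cis2pi y"
  by (simp add: cis2pi_def distrib_left exp_add)

lemma cis2pi_diff: "cis2pi (x - y) = cis2pi x / cis2pi y"
  by (simp add: cis2pi_def right_diff_distrib exp_diff)

lemma cis2pi_minus: "cis2pi (- x) = inverse (cis2pi x)"
  by (simp add: cis2pi_def exp_minus)

lemma cis2pi_0 [simp]: "cis2pi 0 = 1"
  by (simp add: cis2pi_def)

lemma cis2pi_of_nat_mult: "cis2pi (of_nat n * z) = cis2pi z ^ n"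
  by (simp add: cis2pi_def exp_of_nat_mult[symmetric] algebra_simps)

lemma cis2pi_eq_1_iff: "cis2pi z = 1 \<longleftrightarrow> z \<in> \<int>"
proof -
  have "cis2pi z = 1 \<longleftrightarrow> (\<exists>n::int. 2 * pi * Re z = of_int (2 * n) * pi \<and> Im z = 0)"
    by (auto simp: cis2pi_def exp_eq_1)
  also have "\<dots> \<longleftrightarrow> (\<exists>n::int. z = of_int n)"
    by (auto simp: complex_eq_iff)
  finally show ?thesis
    by (auto elim: Ints_cases)
qed

lemma norm_cis2pi: "norm (cis2pi z) = exp (- 2 * pi * Im z)"
  by (simp add: cis2pi_def norm_exp_eq_Re)

lemma norm_cis2pi_less_1 [simp]: "Im \<tau> > 0 \<Longrightarrow> norm (cis2pi \<tau>) < 1"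
  by (simp add: norm_cis2pi)

lemma holomorphic_on_cis2pi [holomorphic_intros]:
  "f holomorphic_on S \<Longrightarrow> (\<lambda>z. cis2pi (f z)) holomorphic_on S"
  unfolding cis2pi_def by (intro holomorphic_intros)

text \<open>Up to a constant factor this is \<open>\<theta>\<^sub>1(z | \<tau>) / \<theta>\<^sub>1'(0 | \<tau>)\<close>.\<close>

definition ntheta :: "complex \<Rightarrow> complex \<Rightarrow> complex"
  where "ntheta z \<tau> = exp (- (pi * \<i> * z)) * qprod (cis2pi z) (cis2pi \<tau>) *
           qprod (cis2pi \<tau> / cis2pi z) (cis2pi \<tau>) / qprod (cis2pi \<tau>) (cis2pi \<tau>) ^ 2"

lemma qprod_cis2pi_nonzero:
  assumes "Im \<tau> > 0"
  shows "qprod (cis2pi \<tau>) (cis2pi \<tau>) \<noteq> 0"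
proof -
  have "cis2pi \<tau> * cis2pi \<tau> ^ j \<noteq> 1" for j
  proof -
    have "cis2pi \<tau> * cis2pi \<tau> ^ j = cis2pi (of_nat (Suc j) * \<tau>)"
      by (simp only: cis2pi_of_nat_mult power_Suc)
    moreover have "Im (of_nat (Suc j) * \<tau>) > 0"
      using assms by (simp add: distrib_right add_pos_nonneg)
    ultimately show ?thesis
      by (metis norm_cis2pi_less_1 norm_one order_less_irrefl)
  qed
  then show ?thesis
    using assms by (simp add: qprod_eq_0_iff)
qed

lemma holomorphic_on_ntheta [holomorphic_intros]:
  assumes "f holomorphic_on S" "Im \<tau> > 0"
  shows "(\<lambda>z. ntheta (f z) \<tau>) holomorphic_on S"
  unfolding ntheta_def using assms
  by (intro holomorphic_intros) (auto simp: qprod_cis2pi_nonzero)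

text \<open>The products depend on \<open>z\<close> only through \<open>cis2pi z\<close>, so the
  sign comes entirely from the half-period prefactor \<open>exp (- (pi * \<i> * z))\<close>.\<close>

lemma ntheta_add_1:
  assumes "Im \<tau> > 0"
  shows "ntheta (z + 1) \<tau> = - ntheta z \<tau>"
proof -
  have "cis2pi 1 = 1"
    by (simp add: cis2pi_eq_1_iff)
  then have "cis2pi (z + 1) = cis2pi z"
    by (simp add: cis2pi_add)
  moreover have "exp (- (pi * \<i> * (z + 1))) = - exp (- (pi * \<i> * z))"
    by (simp add: distrib_left exp_diff exp_minus)
  ultimately show ?thesis
    by (simp add: ntheta_def)
qed

text \<open>Replacing \<open>w\<close> by \<open>w * q\<close> removes the factor
  \<open>1 - w\<close> from one product and adds \<open>1 - 1 / w\<close> to the other, and (1 -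
  1/w) = -(1 - w)/w. Nothing is divided by \<open>1 - w\<close>, so \<open>w = 1\<close> is no
  exception. Both the translation by \<tau> and the reflection z \<mapsto> -z reduce to this
  identity.\<close>

lemma qprod_theta_shift:
  assumes q: "norm q < 1" and "w \<noteq> 0"
  shows "qprod (w * q) q * qprod (1 / w) q = - (qprod w q * qprod (q / w) q) / w"
proof -
  have "qprod (1 / w) q = (1 - 1 / w) * qprod (q / w) q"
    using qprod_rec[OF q, of "1 / w"] by simp
  moreover have "qprod w q = (1 - w) * qprod (w * q) q"
    using qprod_rec[OF q, of w] .
  ultimately show ?thesis
    using \<open>w \<noteq> 0\<close> by (simp only:) (simp add: divide_simps, simp add: algebra_simps)
qed

lemma ntheta_add_tau:
  assumes "Im \<tau> > 0"
  shows "ntheta (z + \<tau>) \<tau> = - exp (- (pi * \<i> * (\<tau> + 2 * z))) * ntheta z \<tau>"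
proof -
  have 1: "exp (- (pi * \<i> * (z + \<tau>))) = exp (- (pi * \<i> * (\<tau> + 2 * z))) * exp (- (pi * \<i> * z)) * cis2pi z"
    by (simp add: cis2pi_def exp_add[symmetric] algebra_simps)
  have 2: "qprod (cis2pi z * cis2pi \<tau>) (cis2pi \<tau>) * qprod (1 / cis2pi z) (cis2pi \<tau>) =
    - (qprod (cis2pi z) (cis2pi \<tau>) * qprod (cis2pi \<tau> / cis2pi z) (cis2pi \<tau>)) / cis2pi z"
    using assms by (intro qprod_theta_shift) auto
  have "ntheta (z + \<tau>) \<tau> = exp (- (pi * \<i> * (z + \<tau>))) *
     (qprod (cis2pi z * cis2pi \<tau>) (cis2pi \<tau>) * qprod (1 / cis2pi z) (cis2pi \<tau>)) / qprod (cis2pi \<tau>) (cis2pi \<tau>) ^ 2"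
    by (simp add: ntheta_def cis2pi_add)
  also have "\<dots> = - exp (- (pi * \<i> * (\<tau> + 2 * z))) * ntheta z \<tau>"
    unfolding 1 2 by (simp add: ntheta_def)
  finally show ?thesis .
qed

lemma ntheta_minus:
  assumes "Im \<tau> > 0"
  shows "ntheta (- z) \<tau> = - ntheta z \<tau>"
proof -
  have 2: "qprod (cis2pi z * cis2pi \<tau>) (cis2pi \<tau>) * qprod (1 / cis2pi z) (cis2pi \<tau>) =
    - (qprod (cis2pi z) (cis2pi \<tau>) * qprod (cis2pi \<tau> / cis2pi z) (cis2pi \<tau>)) / cis2pi z"
    using assms by (intro qprod_theta_shift) auto
  have 1: "exp (pi * \<i> * z) = exp (- (pi * \<i> * z)) * cis2pi z"
    by (simp add: cis2pi_def exp_add[symmetric] algebra_simps)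
  have "ntheta (- z) \<tau> = exp (pi * \<i> * z) *
     (qprod (cis2pi z * cis2pi \<tau>) (cis2pi \<tau>) * qprod (1 / cis2pi z) (cis2pi \<tau>)) / qprod (cis2pi \<tau>) (cis2pi \<tau>) ^ 2"
    by (simp add: ntheta_def cis2pi_minus field_simps)
  also have "\<dots> = - ntheta z \<tau>"
    unfolding 1 2 by (simp add: ntheta_def)
  finally show ?thesis .
qed

text \<open>The first product vanishes at the points m - j \<tau> and the second at (j + 1) \<tau> -
  m with j \<ge> 0; the two families together exhaust the lattice, which explains the case split on
  the sign of \<open>n\<close>.\<close>

lemma ntheta_eq_0_iff:
  assumes "Im \<tau> > 0"
  shows "ntheta z \<tau> = 0 \<longleftrightarrow> (\<exists>m n :: int. z = of_int m + of_int n * \<tau>)"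
proof -
  let ?q = "cis2pi \<tau>"
  have 1: "cis2pi z * ?q ^ j = cis2pi (z + of_nat j * \<tau>)" for j
    by (simp add: cis2pi_add cis2pi_of_nat_mult)
  have 2: "?q / cis2pi z * ?q ^ j = cis2pi (of_nat (Suc j) * \<tau> - z)" for j
    unfolding cis2pi_diff cis2pi_of_nat_mult by simp
  have "ntheta z \<tau> = 0 \<longleftrightarrow> qprod (cis2pi z) ?q = 0 \<or> qprod (?q / cis2pi z) ?q = 0"
    using qprod_cis2pi_nonzero[OF assms] by (simp add: ntheta_def)
  also have "\<dots> \<longleftrightarrow>
      (\<exists>j. cis2pi (z + of_nat j * \<tau>) = 1) \<or> (\<exists>j. cis2pi (of_nat (Suc j) * \<tau> - z) = 1)"
    using assms by (simp only: qprod_eq_0_iff norm_cis2pi_less_1 1 2)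
  also have "\<dots> \<longleftrightarrow> (\<exists>m n :: int. z = of_int m + of_int n * \<tau>)" (is "?L \<longleftrightarrow> ?R")
  proof
    assume ?L
    then consider j m where "z + of_nat j * \<tau> = of_int m" | j m where "of_nat (Suc j) * \<tau> - z = of_int m"
      unfolding cis2pi_eq_1_iff by (auto elim!: Ints_cases)
    then show ?R
    proof cases
      case 1
      then have "z = of_int m + of_int (- int j) * \<tau>" by (simp add: algebra_simps)
      then show ?thesis by blast
    next
      case 2
      then have "z = of_int (- m) + of_int (int (Suc j)) * \<tau>" by (simp add: algebra_simps)
      then show ?thesis by blast
    qed
  next
    assume ?R
    then obtain m n :: int where z: "z = of_int m + of_int n * \<tau>" by blast
    show ?L
    proof (cases "n \<le> 0")
      case True
      then have "z + of_nat (nat (- n)) * \<tau> = of_int m"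
        by (simp add: z algebra_simps)
      then have "cis2pi (z + of_nat (nat (- n)) * \<tau>) = 1"
        by (simp only: cis2pi_eq_1_iff Ints_of_int)
      then show ?thesis by blast
    next
      case False
      then have "of_nat (Suc (nat (n - 1))) * \<tau> - z = of_int (- m)"
        by (simp add: z algebra_simps)
      then have "cis2pi (of_nat (Suc (nat (n - 1))) * \<tau> - z) = 1"
        by (simp only: cis2pi_eq_1_iff Ints_of_int)
      then show ?thesis by blast
    qed
  qed
  finally show ?thesis .
qed

text \<open>The factor \<open>1 - cis2pi z\<close> split off the first product combines with the
  prefactor to an odd function with a simple zero at 0, and the remaining quotient \<psi> is 1
  there. The squared product in the denominator of \<open>ntheta\<close> makes the value independent
  of \<tau>; hence no multiplier appears in \<open>ntheta_modular\<close>.\<close>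

lemma DERIV_ntheta_0:
  assumes "Im \<tau> > 0"
  shows "((\<lambda>z. ntheta z \<tau>) has_field_derivative (- (2 * pi * \<i>))) (at 0)"
proof -
  let ?q = "cis2pi \<tau>"
  define \<psi> where "\<psi> = (\<lambda>z. qprod (cis2pi z * ?q) ?q * qprod (?q / cis2pi z) ?q / qprod ?q ?q ^ 2)"
  have eq: "ntheta z \<tau> = (exp (- (pi * \<i> * z)) - exp (pi * \<i> * z)) * \<psi> z" for z
  proof -
    have 1: "exp (pi * \<i> * z) = exp (- (pi * \<i> * z)) * cis2pi z"
      by (simp add: cis2pi_def exp_add[symmetric] algebra_simps)
    have 2: "qprod (cis2pi z) ?q = (1 - cis2pi z) * qprod (cis2pi z * ?q) ?q"
      by (rule qprod_rec) (use assms in simp)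
    show ?thesis
      unfolding ntheta_def 2 1 \<psi>_def by (simp add: algebra_simps)
  qed
  have "\<psi> holomorphic_on UNIV"
    unfolding \<psi>_def using assms by (intro holomorphic_intros) (auto simp: qprod_cis2pi_nonzero)
  then obtain D where D: "(\<psi> has_field_derivative D) (at 0)"
    by (auto simp: holomorphic_on_open)
  have "\<psi> 0 = 1"
    using assms by (simp add: \<psi>_def qprod_cis2pi_nonzero power2_eq_square)
  then show ?thesis
    unfolding eq by (auto intro!: derivative_eq_intros D)
qed

section \<open>Modular transformation of the theta function\<close>

text \<open>The factor of automorphy for the translation by m + n \<tau>. The sign (-1)^(m+n) is
  kept inside the exponential so that identities between such factors become identities between
  exponents.\<close>

definition theta_factor :: "complex \<Rightarrow> int \<Rightarrow> int \<Rightarrow> complex \<Rightarrow> complex"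
  where "theta_factor \<tau> m n z =
    exp (pi * \<i> * (of_int m + of_int n - of_int (n ^ 2) * \<tau> - 2 * of_int n * z))"

lemma theta_factor_nonzero [simp]: "theta_factor \<tau> m n z \<noteq> 0"
  by (simp add: theta_factor_def)

lemma quasi_periodic:
  fixes h :: "complex \<Rightarrow> complex"
  assumes h1: "\<And>z. h (z + 1) = - h z"
    and h\<tau>: "\<And>z. h (z + \<tau>) = - exp (- (pi * \<i> * (\<tau> + 2 * z))) * h z"
  shows "h (z + of_int m + of_int n * \<tau>) = theta_factor \<tau> m n z * h z"
proof -
  have em: "exp (pi * \<i>) = (-1 :: complex)"
    by simp
  have m: "h (z + of_int m) = exp (pi * \<i> * of_int m) * h z" for z
  proof (induction m rule: int_induct[where k = 0])
    case (step1 i)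
    have "h (z + of_int (i + 1)) = - h (z + of_int i)"
      using h1[of "z + of_int i"] by (simp add: add.assoc)
    also have "\<dots> = exp (pi * \<i> * of_int (i + 1)) * h z"
      using step1 em by (simp add: distrib_left exp_add)
    finally show ?case .
  next
    case (step2 i)
    have "h (z + of_int i) = - h (z + of_int (i - 1))"
      using h1[of "z + of_int (i - 1)"] by (simp add: algebra_simps)
    then have "h (z + of_int (i - 1)) = - exp (pi * \<i> * of_int i) * h z"
      using step2 by simp
    then show ?case
      using em by (simp add: right_diff_distrib exp_diff)
  qed simp
  define F where "F = (\<lambda>n z. exp (pi * \<i> * (of_int n - of_int (n ^ 2) * \<tau> - 2 * of_int n * z)))"
  have F: "F (i + 1) z = - exp (- (pi * \<i> * (\<tau> + 2 * (z + of_int i * \<tau>)))) * F i z" for i z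
  proof -
    have "- exp (- (pi * \<i> * (\<tau> + 2 * (z + of_int i * \<tau>)))) * F i z =
      exp (pi * \<i>) * exp (- (pi * \<i> * (\<tau> + 2 * (z + of_int i * \<tau>)))) * F i z"
      by simp
    also have "\<dots> = F (i + 1) z"
      \<comment> \<open>The exponents match because (i + 1)^2 - i^2 = 2 i + 1, the minus sign being
        written as \<open>exp (pi * \<i>)\<close>.\<close>
      unfolding F_def exp_add[symmetric] by (rule arg_cong[of _ _ exp]) (simp add: power2_eq_square algebra_simps)
    finally show ?thesis ..
  qed
  have step: "h (z + of_int (i + 1) * \<tau>) = - exp (- (pi * \<i> * (\<tau> + 2 * (z + of_int i * \<tau>)))) * h (z + of_int i * \<tau>)" for i
    using h\<tau>[of "z + of_int i * \<tau>"] by (simp add: algebra_simps)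
  have n: "h (z + of_int n * \<tau>) = F n z * h z"
  proof (induction n rule: int_induct[where k = 0])
    case base
    show ?case by (simp add: F_def)
  next
    case (step1 i)
    then show ?case
      unfolding step F by (simp add: algebra_simps)
  next
    case (step2 i)
    have "- exp (- (pi * \<i> * (\<tau> + 2 * (z + of_int (i - 1) * \<tau>)))) * h (z + of_int (i - 1) * \<tau>) =
      - exp (- (pi * \<i> * (\<tau> + 2 * (z + of_int (i - 1) * \<tau>)))) * F (i - 1) z * h z"
      using step2 step[of "i - 1"] F[of "i - 1" z] by simp
    then show ?case by simp
  qed
  have "h (z + of_int m + of_int n * \<tau>) = h ((z + of_int n * \<tau>) + of_int m)"
    by (simp add: algebra_simps)
  also have "\<dots> = exp (pi * \<i> * of_int m) * F n z * h z"
    by (simp add: m n)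
  also have "exp (pi * \<i> * of_int m) * F n z = theta_factor \<tau> m n z"
    unfolding F_def theta_factor_def exp_add[symmetric] by (rule arg_cong[of _ _ exp]) (simp add: algebra_simps)
  finally show ?thesis .
qed

lemma ntheta_quasi_periodic:
  assumes "Im \<tau> > 0"
  shows "ntheta (z + of_int m + of_int n * \<tau>) \<tau> = theta_factor \<tau> m n z * ntheta z \<tau>"
  by (rule quasi_periodic) (rule ntheta_add_1 ntheta_add_tau, rule assms)+

lemma lattice_reduction:
  assumes "Im \<tau> > 0"
  obtains m n :: int and x y :: real
  where "z = of_real x + of_real y * \<tau> + of_int m + of_int n * \<tau>" "x \<in> {0..1}" "y \<in> {0..1}"
proof -
  define y where "y = Im z / Im \<tau>"
  define x where "x = Re z - y * Re \<tau>"
  have "z = of_real x + of_real y * \<tau>"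
    using assms by (simp add: complex_eq_iff x_def y_def)
  also have "\<dots> = of_real (frac x) + of_real (frac y) * \<tau> + of_int \<lfloor>x\<rfloor> + of_int \<lfloor>y\<rfloor> * \<tau>"
    by (simp add: frac_def algebra_simps)
  finally show ?thesis
    using that[of "frac x" "frac y" "\<lfloor>x\<rfloor>" "\<lfloor>y\<rfloor>"] by (simp add: frac_ge_0 less_imp_le[OF frac_lt_1])
qed

text \<open>The quotient of \<open>N\<close> and \<open>D\<close> is elliptic. Its only possible
  poles are lattice points, where the zero of \<open>D\<close> is simple because \<delta> \<noteq> 0
  and is cancelled by a zero of \<open>N\<close>. So it is entire and bounded by its values on one
  period parallelogram, hence constant, and the limit at 0 is the quotient of the
  derivatives.\<close>

lemma theta_uniqueness:
  fixes N D :: "complex \<Rightarrow> complex" and \<delta> \<nu> :: complex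
  assumes \<tau>: "Im \<tau> > 0"
    and holN: "N holomorphic_on UNIV" and holD: "D holomorphic_on UNIV"
    and perN: "\<And>z m n. N (z + of_int m + of_int n * \<tau>) = theta_factor \<tau> m n z * N z"
    and perD: "\<And>z m n. D (z + of_int m + of_int n * \<tau>) = theta_factor \<tau> m n z * D z"
    and D0: "\<And>z. D z = 0 \<longleftrightarrow> (\<exists>m n :: int. z = of_int m + of_int n * \<tau>)"
    and N0: "N 0 = 0"
    and dN: "(N has_field_derivative \<nu>) (at 0)" and dD: "(D has_field_derivative \<delta>) (at 0)"
    and \<delta>: "\<delta> \<noteq> 0"
  shows "N z = \<nu> / \<delta> * D z"
proof -
  \<comment> \<open>The value at the zeros of \<open>D\<close> is the limit of
    \<open>N z / D z\<close> at 0, which periodicity transports to every lattice point; thus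
    \<open>F\<close> is the holomorphic extension of the quotient.\<close>
  define F where "F = (\<lambda>z. if D z = 0 then \<nu> / \<delta> else N z / D z)"
  have perF: "F (z + of_int m + of_int n * \<tau>) = F z" for z m n
    by (simp add: F_def perN perD)
  have D_at_0: "D 0 = 0"
    using D0[of 0] by (metis add.right_neutral mult_zero_left of_int_0)
  have contD: "continuous_on UNIV D"
    using holD by (rule holomorphic_on_imp_continuous_on)
  have openD: "open {z. D z \<noteq> 0}"
    using contD by (simp add: open_Collect_neq)
  have limD: "((\<lambda>z. D z / z) \<longlongrightarrow> \<delta>) (at 0)"
    using dD by (simp add: has_field_derivative_iff D_at_0)
  have limN: "((\<lambda>z. N z / z) \<longlongrightarrow> \<nu>) (at 0)"
    using dN by (simp add: has_field_derivative_iff N0)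
  have "\<forall>\<^sub>F z in at 0. D z / z \<noteq> 0"
    using limD \<delta> by (rule tendsto_imp_eventually_ne)
  then obtain r where r: "r > 0" "\<And>z. z \<noteq> 0 \<Longrightarrow> norm z < r \<Longrightarrow> D z \<noteq> 0"
    unfolding eventually_at by (auto simp: dist_norm)
  have holND: "(\<lambda>z. N z / D z) holomorphic_on {z. D z \<noteq> 0}"
    by (intro holomorphic_intros) (auto intro: holomorphic_on_subset[OF holN] holomorphic_on_subset[OF holD])
  have F_off: "F field_differentiable (at z)" if "D z \<noteq> 0" for z
  proof -
    have "F holomorphic_on {z. D z \<noteq> 0}"
      by (rule holomorphic_transform[OF holND]) (simp add: F_def)
    then show ?thesis
      using openD that holomorphic_on_imp_differentiable_at by blast
  qed
  have lim0: "((\<lambda>z. N z / D z) \<longlongrightarrow> \<nu> / \<delta>) (at 0)"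
  proof -
    have "((\<lambda>z. (N z / z) / (D z / z)) \<longlongrightarrow> \<nu> / \<delta>) (at 0)"
      by (intro tendsto_intros limN limD \<delta>)
    then show ?thesis
      by (rule Lim_transform_eventually) (auto simp: eventually_at_filter)
  qed
  have F_0: "F field_differentiable (at 0)"
  proof -
    have "(\<lambda>z. if z = 0 then \<nu> / \<delta> else N z / D z) holomorphic_on ball 0 r"
      by (rule removable_singularity[OF _ _ lim0])
        (use r in \<open>auto intro!: holomorphic_on_subset[OF holND]\<close>)
    then have "F holomorphic_on ball 0 r"
      by (rule holomorphic_transform) (use r D_at_0 in \<open>auto simp: F_def\<close>)
    then show ?thesis
      using r(1) holomorphic_on_imp_differentiable_at[of F "ball 0 r" 0] by simp
  qed
  have holF: "F holomorphic_on UNIV"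
    unfolding holomorphic_on_def
  proof safe
    fix z
    show "F field_differentiable (at z)"
    proof (cases "D z = 0")
      case True
      then obtain m n :: int where z: "z = of_int m + of_int n * \<tau>"
        using D0 by blast
      \<comment> \<open>Translation by the lattice point \<open>z\<close> carries differentiability
        at 0 to differentiability at \<open>z\<close>.\<close>
      have "F = F \<circ> (\<lambda>w. w - z)"
      proof
        fix w
        show "F w = (F \<circ> (\<lambda>w. w - z)) w"
          using perF[of "w - z" m n] by (simp add: z algebra_simps)
      qed
      moreover have "(F \<circ> (\<lambda>w. w - z)) field_differentiable (at z)"
        by (rule field_differentiable_compose) (use F_0 in \<open>auto intro!: derivative_intros\<close>)
      ultimately show ?thesis
        by simp
    qed (rule F_off)
  qed
  have contF: "continuous_on UNIV F"
    using holF by (rule holomorphic_on_imp_continuous_on)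
  \<comment> \<open>The closed period parallelogram: compact, and its lattice translates cover the
    plane.\<close>
  define K where "K = (\<lambda>(x, y). of_real x + of_real y * \<tau>) ` ({0..1::real} \<times> {0..1::real})"
  have "compact K"
    unfolding K_def
    by (intro compact_continuous_image compact_Times compact_Icc)
      (auto simp: case_prod_unfold intro!: continuous_intros)
  then have "compact (F ` K)"
    using compact_continuous_image[OF continuous_on_subset[OF contF subset_UNIV], of K] by simp
  moreover have "range F \<subseteq> F ` K"
  proof safe
    fix z
    obtain m n x y where "z = of_real x + of_real y * \<tau> + of_int m + of_int n * \<tau>" "x \<in> {0..1}" "y \<in> {0..1}"
      by (rule lattice_reduction[OF \<tau>, of z])
    then show "F z \<in> F ` K"
      by (auto simp: perF K_def intro!: imageI rev_image_eqI[of "(x, y)"])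
  qed
  ultimately have "bounded (range F)"
    using bounded_subset compact_imp_bounded by blast
  with holF have "F constant_on UNIV"
    by (rule Liouville_theorem)
  then have "F z = F 0"
    by (auto simp: constant_on_def)
  then have F_eq: "F z = \<nu> / \<delta>"
    by (simp add: F_def D_at_0)
  \<comment> \<open>At a zero of \<open>D\<close> the value of \<open>F\<close> says nothing about
    \<open>N\<close>; there \<open>N\<close> vanishes by quasi-periodicity from
    \<open>N 0 = 0\<close>.\<close>
  show ?thesis
  proof (cases "D z = 0")
    case True
    then obtain m n :: int where "z = 0 + of_int m + of_int n * \<tau>"
      using D0 by auto
    then have "N z = 0"
      using perN[of 0 m n] N0 by simp
    with True show ?thesis by simp
  next
    case False
    with F_eq show ?thesis by (simp add: F_def field_simps)
  qed
qed

lemma Im_moebius_pos: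
  fixes a b c d :: int
  assumes \<tau>: "Im \<tau> > 0" and det: "a * d - b * c = 1"
  defines "j \<equiv> of_int c * \<tau> + of_int d"
  shows "j \<noteq> 0" and "Im ((of_int a * \<tau> + of_int b) / j) > 0"
proof -
  show j: "j \<noteq> 0"
  proof
    assume "j = 0"
    then have "of_int c * Im \<tau> = 0" "of_int c * Re \<tau> + of_int d = 0"
      by (auto simp: j_def complex_eq_iff)
    with \<tau> have "c = 0" "d = 0" by auto
    with det show False by simp
  qed
  have "Im ((of_int a * \<tau> + of_int b) / j) = Im ((of_int a * \<tau> + of_int b) * cnj j) / (cmod j)\<^sup>2"
    by (simp add: complex_div_cnj[of _ j] flip: of_real_power)
  also have "Im ((of_int a * \<tau> + of_int b) * cnj j) = of_int (a * d - b * c) * Im \<tau>"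
    by (simp add: j_def algebra_simps)
  finally show "Im ((of_int a * \<tau> + of_int b) / j) > 0"
    using \<tau> j det by simp
qed

text \<open>The Jacobi form law of weight -1 and index 1/2 with trivial multiplier. Dividing the
  left side by the Gaussian exponential gives a function \<open>N\<close> with the same factors of
  automorphy in \<open>z\<close> as \<open>ntheta z \<tau>\<close>; by
  \<open>theta_uniqueness\<close> the two are proportional, with ratio \<open>1 / j\<close> read off
  from the derivatives at 0.\<close>

theorem ntheta_modular:
  fixes a b c d :: int
  assumes \<tau>: "Im \<tau> > 0" and det: "a * d - b * c = 1"
  defines "j \<equiv> of_int c * \<tau> + of_int d" and "\<tau>' \<equiv> (of_int a * \<tau> + of_int b) / (of_int c * \<tau> + of_int d)"
  shows "ntheta (z / j) \<tau>' = exp (pi * \<i> * of_int c * z\<^sup>2 / j) / j * ntheta z \<tau>"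
proof -
  have j: "j \<noteq> 0" and \<tau>': "Im \<tau>' > 0"
    using Im_moebius_pos[OF \<tau> det] by (simp_all add: j_def \<tau>'_def)
  have j\<tau>': "\<tau>' * j = of_int a * \<tau> + of_int b"
    using j by (simp add: \<tau>'_def j_def)
  have detC: "of_int a * of_int d - of_int b * of_int c = (1::complex)"
    using arg_cong[OF det, of "of_int :: int \<Rightarrow> complex"] by simp
  define E where "E = (\<lambda>z. exp (- (pi * \<i> * of_int c * z\<^sup>2 / j)))"
  define N where "N = (\<lambda>z. ntheta (z / j) \<tau>' * E z)"
  have shift: "N (z + of_int m + of_int n * \<tau>) = theta_factor \<tau> m n z * N z" for z m n
  proof -
    \<comment> \<open>The integers \<open>m'\<close> and \<open>n'\<close> are the coordinates of
      \<open>\<omega> / j\<close> in the basis 1, \<tau>', obtained by inverting the integral change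
      of basis of determinant 1.\<close>
    define m' where "m' = a * m - b * n"
    define n' where "n' = d * n - c * m"
    define \<omega> where "\<omega> = of_int m + of_int n * \<tau>"
    have \<omega>: "\<omega> = (of_int m' + of_int n' * \<tau>') * j"
    proof -
      have "(of_int m' + of_int n' * \<tau>') * j = of_int m' * j + of_int n' * (of_int a * \<tau> + of_int b)"
        by (simp add: distrib_right j\<tau>' mult.assoc)
      also have "\<dots> = (of_int a * of_int d - of_int b * of_int c) * \<omega>"
        by (simp add: m'_def n'_def j_def \<omega>_def algebra_simps)
      finally show ?thesis
        by (simp add: detC)
    qed
    have "N (z + \<omega>) = ntheta (z / j + of_int m' + of_int n' * \<tau>') \<tau>' * E (z + \<omega>)"
      using j by (simp add: N_def \<omega> add_divide_distrib add.assoc)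
    also have "\<dots> = ntheta (z / j) \<tau>' * (theta_factor \<tau>' m' n' (z / j) * E (z + \<omega>))"
      by (simp add: ntheta_quasi_periodic[OF \<tau>'])
    also have "theta_factor \<tau>' m' n' (z / j) * E (z + \<omega>) = theta_factor \<tau> m n z * E z"
    proof -
      \<comment> \<open>\<open>k\<close> is the discrepancy of the two exponents in units of \<pi>
        i. It is even because m + n + m n = (m + 1)(n + 1) - 1 is even exactly when \<open>m\<close>
        and \<open>n\<close> both are, a condition preserved by unimodular substitutions.\<close>
      define k where "k = m' + n' + m' * n' - (m + n + m * n)"
      have "m = d * m' + b * n'" "n = c * m' + a * n'"
      proof -
        have "d * m' + b * n' = (a * d - b * c) * m" "c * m' + a * n' = (a * d - b * c) * n"
          by (simp_all add: m'_def n'_def algebra_simps)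
        then show "m = d * m' + b * n'" "n = c * m' + a * n'"
          by (simp_all add: det)
      qed
      then have "even m' \<and> even n' \<longleftrightarrow> even m \<and> even n"
        by (metis m'_def n'_def dvd_add dvd_diff dvd_mult)
      then have "even k"
        by (auto simp: k_def)
      then obtain l where l: "k = 2 * l" by blast
      \<comment> \<open>The relations \<open>h1\<close> and \<open>h2\<close> rewrite the terms of c
        (z + \<omega>)^2 / j that are linear and constant in \<open>z\<close>, so that \<tau>' drops
        out of the exponent.\<close>
      have h1: "of_int n' + of_int c * \<omega> = of_int n * j"
        by (simp add: n'_def \<omega>_def j_def algebra_simps)
      have h2: "\<omega> / j = of_int m' + of_int n' * \<tau>'"
        using j by (simp add: \<omega>)
      have "of_int n' * z / j + of_int c * \<omega> * z / j = (of_int n' + of_int c * \<omega>) * z / j"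
        by (simp add: add_divide_distrib distrib_right)
      also have "\<dots> = of_int n * z"
        using j by (simp add: h1)
      finally have lin: "of_int n' * z / j = of_int n * z - of_int c * \<omega> * z / j"
        by (simp add: algebra_simps)
      have "of_int c * \<omega> * (\<omega> / j) = (of_int n * j - of_int n') * (\<omega> / j)"
        by (simp flip: h1)
      also have "\<dots> = of_int n * \<omega> - of_int n' * (of_int m' + of_int n' * \<tau>')"
        unfolding h2[symmetric] using j by (simp add: left_diff_distrib diff_divide_distrib)
      finally have quad: "of_int c * \<omega>\<^sup>2 / j = of_int n * \<omega> - of_int n' * (of_int m' + of_int n' * \<tau>')"
        by (simp add: power2_eq_square mult.assoc)
      have sq: "of_int c * (z + \<omega>)\<^sup>2 / j = of_int c * z\<^sup>2 / j + 2 * (of_int c * \<omega> * z / j) + of_int c * \<omega>\<^sup>2 / j"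
        unfolding power2_sum distrib_left add_divide_distrib by (simp add: mult_ac)
      have "theta_factor \<tau>' m' n' (z / j) * E (z + \<omega>) =
          exp (pi * \<i> * (of_int m' + of_int n' - of_int (n' ^ 2) * \<tau>' - 2 * (of_int n' * z / j) - of_int c * (z + \<omega>)\<^sup>2 / j))"
        unfolding theta_factor_def E_def exp_add[symmetric] right_diff_distrib distrib_left
        by (rule arg_cong[of _ _ exp]) (simp add: mult_ac)
      also have "\<dots> = exp (pi * \<i> * (of_int m + of_int n - of_int (n ^ 2) * \<tau> - 2 * of_int n * z
          - of_int c * z\<^sup>2 / j + 2 * of_int l))"
        unfolding lin sq quad
      proof (intro arg_cong[of _ _ exp] arg_cong2[of _ _ _ _ "(*)"] refl)
        have "2 * of_int l = (of_int m' + of_int n' + of_int m' * of_int n' - (of_int m + of_int n + of_int m * of_int n) :: complex)"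
          using arg_cong[OF l, of "of_int :: int \<Rightarrow> complex"] by (simp add: k_def)
        then show "of_int m' + of_int n' - of_int (n' ^ 2) * \<tau>' -
            2 * (of_int n * z - of_int c * \<omega> * z / j) -
            (of_int c * z\<^sup>2 / j + 2 * (of_int c * \<omega> * z / j) + (of_int n * \<omega> - of_int n' * (of_int m' + of_int n' * \<tau>'))) =
          of_int m + of_int n - of_int (n ^ 2) * \<tau> - 2 * of_int n * z - of_int c * z\<^sup>2 / j + 2 * of_int l"
          by (simp add: right_diff_distrib) (simp add: \<omega>_def power2_eq_square ring_distribs mult_ac)
      qed
      also have "\<dots> = theta_factor \<tau> m n z * E z * exp (2 * of_int l * pi * \<i>)"
        unfolding theta_factor_def E_def exp_add[symmetric] right_diff_distrib distrib_left
        by (rule arg_cong[of _ _ exp]) (simp add: mult_ac)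
      also have "exp (2 * of_int l * pi * \<i>) = (1 :: complex)"
        using exp_integer_2pi[of "of_int l"] by simp
      finally show ?thesis by simp
    qed
    finally show ?thesis
      by (simp add: N_def \<omega>_def mult_ac add.assoc)
  qed
  have hol: "(\<lambda>z. ntheta (z / j) \<tau>') holomorphic_on UNIV" "E holomorphic_on UNIV"
    unfolding E_def using j \<tau>' by (intro holomorphic_intros; simp)+
  have ntheta_0: "ntheta 0 \<tau> = 0" if "Im \<tau> > 0" for \<tau>
    using ntheta_eq_0_iff[OF that, of 0] by (metis add.right_neutral mult_zero_left of_int_0)
  obtain E' where E': "(E has_field_derivative E') (at 0)"
    using hol(2) by (auto simp: holomorphic_on_open)
  have "((\<lambda>z. ntheta (z / j) \<tau>') has_field_derivative - (2 * pi * \<i>) * (1 / j)) (at 0)"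
  proof (rule DERIV_chain2[where f = "\<lambda>z. ntheta z \<tau>'" and g = "\<lambda>z. z / j"])
    show "((\<lambda>z. ntheta z \<tau>') has_field_derivative - (2 * pi * \<i>)) (at (0 / j))"
      using DERIV_ntheta_0[OF \<tau>'] by simp
    show "((\<lambda>z. z / j) has_field_derivative 1 / j) (at 0)"
      using j by (auto intro!: derivative_eq_intros)
  qed
  \<comment> \<open>In the product rule only the first term survives, since the theta function
    vanishes at 0; and \<open>E 0 = 1\<close>.\<close>
  then have dN: "(N has_field_derivative - (2 * pi * \<i>) * (1 / j)) (at 0)"
    unfolding N_def
    by (rule DERIV_mult'[THEN DERIV_cong, OF _ E']) (simp add: ntheta_0[OF \<tau>'] E_def)
  have "N z = - (2 * pi * \<i>) * (1 / j) / (- (2 * pi * \<i>)) * ntheta z \<tau>"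
  proof (rule theta_uniqueness[OF \<tau>, of N "\<lambda>z. ntheta z \<tau>"])
    show "N holomorphic_on UNIV"
      unfolding N_def by (intro holomorphic_intros hol)
    show "(\<lambda>z. ntheta z \<tau>) holomorphic_on UNIV"
      using \<tau> by (intro holomorphic_intros)
  qed (use shift ntheta_quasi_periodic[OF \<tau>] ntheta_eq_0_iff[OF \<tau>] dN DERIV_ntheta_0[OF \<tau>] in
        \<open>simp_all add: N_def ntheta_0[OF \<tau>']\<close>)
  then have "ntheta (z / j) \<tau>' * E z = ntheta z \<tau> / j"
    by (simp add: N_def)
  then show ?thesis
    by (simp add: E_def exp_minus field_simps)
qed

section \<open>Theta quotients of level \<open>p\<close>\<close>

lemma eq_upto_signI:
  assumes "\<epsilon> = 1 \<or> \<epsilon> = -1" and "\<And>\<tau>. Im \<tau> > 0 \<Longrightarrow> f \<tau> = \<epsilon> * g \<tau>"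
  shows "eq_upto_sign f g"
  using assms by (auto simp: eq_upto_sign_def upper_half_plane_def)

lemma eq_upto_sign_refl [simp]: "eq_upto_sign f f"
  by (simp add: eq_upto_sign_def)

lemma eq_upto_sign_sym: "eq_upto_sign f g \<Longrightarrow> eq_upto_sign g f"
  by (auto simp: eq_upto_sign_def)

lemma eq_upto_sign_trans [trans]:
  assumes "eq_upto_sign f g" "eq_upto_sign g h"
  shows "eq_upto_sign f h"
  using assms by (auto simp: eq_upto_sign_def)

lemma eq_upto_sign_mult:
  assumes "eq_upto_sign f f'" "eq_upto_sign g g'"
  shows "eq_upto_sign (\<lambda>\<tau>. f \<tau> * g \<tau>) (\<lambda>\<tau>. f' \<tau> * g' \<tau>)"
  using assms by (auto simp: eq_upto_sign_def)

lemma eq_upto_sign_divide: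
  assumes "eq_upto_sign f f'" "eq_upto_sign g g'"
  shows "eq_upto_sign (\<lambda>\<tau>. f \<tau> / g \<tau>) (\<lambda>\<tau>. f' \<tau> / g' \<tau>)"
  using assms by (auto simp: eq_upto_sign_def)

text \<open>Up to a constant, the Klein form with characteristic (g/p, 0) evaluated at p \<tau>. The
  Gaussian factor compensates the automorphy factor of \<open>ntheta\<close>, so that only
  \<open>g\<close> modulo \<open>p\<close> matters, up to sign.\<close>

definition kfun :: "nat \<Rightarrow> int \<Rightarrow> complex \<Rightarrow> complex"
  where "kfun p g \<tau> = exp (pi * \<i> * of_int (g ^ 2) * \<tau> / of_nat p) * ntheta (of_int g * \<tau>) (of_nat p * \<tau>)"

definition cong_pm :: "nat \<Rightarrow> int \<Rightarrow> int \<Rightarrow> bool"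
  where "cong_pm p a b \<longleftrightarrow> [a = b] (mod int p) \<or> [a = - b] (mod int p)"

lemma kfun_minus:
  assumes "p > 0" "Im \<tau> > 0"
  shows "kfun p (- g) \<tau> = - kfun p g \<tau>"
  using ntheta_minus[of "of_nat p * \<tau>" "of_int g * \<tau>"] assms by (simp add: kfun_def)

text \<open>The factor of automorphy for one step p \<tau> is absorbed by the Gaussian because (g +
  p)^2 = g^2 + 2 p g + p^2; only the sign remains.\<close>

lemma kfun_add:
  assumes "p > 0" "Im \<tau> > 0"
  shows "kfun p (g + int p) \<tau> = - kfun p g \<tau>"
proof -
  have "ntheta (of_int (g + int p) * \<tau>) (of_nat p * \<tau>) =
    - exp (- (pi * \<i> * (of_nat p * \<tau> + 2 * (of_int g * \<tau>)))) * ntheta (of_int g * \<tau>) (of_nat p * \<tau>)"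
    using ntheta_add_tau[of "of_nat p * \<tau>" "of_int g * \<tau>"] assms by (simp add: distrib_right)
  moreover have "exp (pi * \<i> * of_int ((g + int p) ^ 2) * \<tau> / of_nat p) *
      exp (- (pi * \<i> * (of_nat p * \<tau> + 2 * (of_int g * \<tau>)))) = exp (pi * \<i> * of_int (g ^ 2) * \<tau> / of_nat p)"
    unfolding exp_add[symmetric]
    by (rule arg_cong[of _ _ exp]) (use assms in \<open>simp add: field_simps power2_eq_square\<close>)
  ultimately show ?thesis
    by (simp add: kfun_def flip: mult.assoc)
qed

lemma kfun_add_mult:
  assumes "p > 0" "Im \<tau> > 0"
  shows "kfun p (g + int p * k) \<tau> = (- 1) powi k * kfun p g \<tau>"
proof (induction k rule: int_induct[where k = 0])
  case (step1 i)
  then show ?case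
    using kfun_add[OF assms, of "g + int p * i"] by (simp add: power_int_add algebra_simps)
next
  case (step2 i)
  then show ?case
    using kfun_add[OF assms, of "g + int p * (i - 1)"] by (simp add: power_int_diff algebra_simps)
qed simp

lemma kfun_cong_pm:
  assumes "p > 0" "cong_pm p g h"
  shows "eq_upto_sign (kfun p g) (kfun p h)"
proof -
  have *: "eq_upto_sign (kfun p g) (kfun p h)" if gh: "[g = h] (mod int p)" for g h
  proof -
    obtain k where k: "g = h + int p * k"
      using cong_sym[OF gh] by (auto simp: cong_iff_lin)
    have "(- 1 :: complex) powi k = 1 \<or> (- 1 :: complex) powi k = - 1"
      by (cases "even k") (simp_all add: power_int_minus_left)
    then show ?thesis
      by (rule eq_upto_signI) (simp add: k kfun_add_mult[OF assms(1)])
  qed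
  have "eq_upto_sign (kfun p (- h)) (kfun p h)"
    by (rule eq_upto_signI[of "-1"]) (simp_all add: kfun_minus[OF assms(1)])
  then show ?thesis
    using assms(2) * eq_upto_sign_trans unfolding cong_pm_def by blast
qed

text \<open>Since \<open>p\<close> divides \<open>c\<close>, the point p \<tau> is moved by the
  integral matrix with rows (a, b p) and (c/p, d), again of determinant 1, and
  \<open>ntheta_modular\<close> applies there. The new argument g (a \<tau> + b) differs from g a
  \<tau> by the integer g b, which costs a sign; the Gaussians combine to the Gaussian for
  \<open>g * a\<close> times a root of unity.\<close>

lemma kfun_modular:
  fixes a b c d :: int
  assumes p: "p > 0" and \<tau>: "Im \<tau> > 0" and det: "a * d - b * c = 1" and c: "int p dvd c"
  defines "j \<equiv> of_int c * \<tau> + of_int d"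
  shows "kfun p g ((of_int a * \<tau> + of_int b) / j) =
    exp (pi * \<i> * (of_int (g * b) + of_int (g ^ 2 * a * b) / of_nat p)) / j * kfun p (g * a) \<tau>"
proof -
  obtain c' where c': "c = int p * c'"
    using c by blast
  have detC: "of_int a * of_int d = 1 + of_int b * (of_int c :: complex)"
    using arg_cong[OF det, of "of_int :: int \<Rightarrow> complex"] by (simp add: algebra_simps)
  define T where "T = of_nat p * \<tau>"
  have T: "Im T > 0"
    using p \<tau> by (simp add: T_def)
  have j: "j \<noteq> 0"
    using Im_moebius_pos(1)[OF \<tau> det] by (simp add: j_def)
  have j': "j = of_int c' * T + of_int d"
    by (simp add: j_def c' T_def mult_ac)
  define w where "w = of_int a * \<tau> + of_int b"
  have pw: "of_nat p * (w / j) = (of_int a * T + of_int (b * int p)) / j"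
    by (simp add: w_def T_def algebra_simps)
  have det': "a * d - b * int p * c' = 1"
    using det by (simp add: c' mult_ac)
  have "ntheta (of_int g * (w / j)) (of_nat p * (w / j)) =
      exp (pi * \<i> * of_int c' * (of_int g * w)\<^sup>2 / j) / j * ntheta (of_int g * w) T"
    unfolding pw unfolding times_divide_eq_right by (rule ntheta_modular[OF T det', folded j'])
  also have "ntheta (of_int g * w) T = ntheta (of_int (g * a) * \<tau> + of_int (g * b) + of_int 0 * T) T"
    by (simp add: w_def algebra_simps)
  also have "\<dots> = exp (pi * \<i> * of_int (g * b)) * ntheta (of_int (g * a) * \<tau>) T"
    unfolding ntheta_quasi_periodic[OF T] theta_factor_def by simp
  finally have 1: "kfun p g (w / j) = exp (pi * \<i> * of_int (g\<^sup>2) * (w / j) / of_nat p) *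
      exp (pi * \<i> * of_int c' * (of_int g * w)\<^sup>2 / j) * exp (pi * \<i> * of_int (g * b)) / j * ntheta (of_int (g * a) * \<tau>) T"
    by (simp add: kfun_def)
  \<comment> \<open>The determinant condition gives 1 + c w = a j, so the denominator
    \<open>j\<close> cancels. In a w = a^2 \<tau> + a b the first term yields the new Gaussian and
    the second the root of unity.\<close>
  have key: "w / j + of_int c * w\<^sup>2 / j = of_int a * w"
  proof -
    have "w / j + of_int c * w\<^sup>2 / j = w * (1 + of_int c * w) / j"
      by (simp add: add_divide_distrib power2_eq_square algebra_simps)
    also have "1 + of_int c * w = of_int a * j"
      using detC by (simp add: w_def j_def algebra_simps)
    finally show ?thesis using j by simp
  qed
  have "pi * \<i> * of_int (g\<^sup>2) * (w / j) / of_nat p + pi * \<i> * of_int c' * (of_int g * w)\<^sup>2 / j =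
     pi * \<i> * of_int (g\<^sup>2) / of_nat p * (w / j + of_int c * w\<^sup>2 / j)"
    using p by (simp add: c' power_mult_distrib field_simps)
  also have "\<dots> = pi * \<i> * of_int (g ^ 2 * a * b) / of_nat p + pi * \<i> * of_int ((g * a)\<^sup>2) * \<tau> / of_nat p"
    unfolding key using p by (simp add: w_def power_mult_distrib power2_eq_square field_simps)
  finally have 2: "exp (pi * \<i> * of_int (g\<^sup>2) * (w / j) / of_nat p) * exp (pi * \<i> * of_int c' * (of_int g * w)\<^sup>2 / j) =
      exp (pi * \<i> * of_int (g ^ 2 * a * b) / of_nat p) * exp (pi * \<i> * of_int ((g * a)\<^sup>2) * \<tau> / of_nat p)"
    by (simp only: exp_add[symmetric])
  have 3: "exp (pi * \<i> * (of_int (g * b) + of_int (g ^ 2 * a * b) / of_nat p)) =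
      exp (pi * \<i> * of_int (g ^ 2 * a * b) / of_nat p) * exp (pi * \<i> * of_int (g * b))"
    unfolding exp_add[symmetric] by (rule arg_cong[of _ _ exp]) (simp add: algebra_simps)
  show ?thesis
    unfolding w_def[symmetric] 1 2 3 by (simp add: kfun_def T_def mult_ac)
qed

section \<open>Quotients of products of Klein forms\<close>

definition kprod :: "nat \<Rightarrow> int list \<Rightarrow> int list \<Rightarrow> complex \<Rightarrow> complex"
  where "kprod p ns ds \<tau> = (\<Prod>g\<leftarrow>ns. kfun p g \<tau>) / (\<Prod>g\<leftarrow>ds. kfun p g \<tau>)"

lemma kprod_cong_pm:
  assumes "p > 0" "list_all2 (cong_pm p) ns ns'" "list_all2 (cong_pm p) ds ds'"
  shows "eq_upto_sign (kprod p ns ds) (kprod p ns' ds')"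
proof -
  have "eq_upto_sign (\<lambda>\<tau>. \<Prod>g\<leftarrow>gs. kfun p g \<tau>) (\<lambda>\<tau>. \<Prod>g\<leftarrow>gs'. kfun p g \<tau>)"
    if "list_all2 (cong_pm p) gs gs'" for gs gs'
    using that by induction (auto intro!: eq_upto_sign_mult kfun_cong_pm assms(1))
  then show ?thesis
    unfolding kprod_def using assms(2,3) by (intro eq_upto_sign_divide) auto
qed

lemma prod_list_kfun_modular:
  fixes a b c d :: int
  assumes p: "p > 0" and \<tau>: "Im \<tau> > 0" and det: "a * d - b * c = 1" and c: "int p dvd c"
  defines "j \<equiv> of_int c * \<tau> + of_int d"
  shows "(\<Prod>g\<leftarrow>gs. kfun p g ((of_int a * \<tau> + of_int b) / j)) =
    exp (pi * \<i> * (of_int (b * sum_list gs) + of_int (a * b * (\<Sum>g\<leftarrow>gs. g ^ 2)) / of_nat p)) / j ^ length gs *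
      (\<Prod>g\<leftarrow>gs. kfun p (a * g) \<tau>)"
proof (induction gs)
  case (Cons g gs)
  have e: "exp (pi * \<i> * (of_int (b * sum_list (g # gs)) + of_int (a * b * (\<Sum>g\<leftarrow>g # gs. g ^ 2)) / of_nat p)) =
    exp (pi * \<i> * (of_int (g * b) + of_int (g ^ 2 * a * b) / of_nat p)) *
    exp (pi * \<i> * (of_int (b * sum_list gs) + of_int (a * b * (\<Sum>g\<leftarrow>gs. g ^ 2)) / of_nat p))"
    unfolding exp_add[symmetric] by (rule arg_cong[of _ _ exp]) (simp add: algebra_simps add_divide_distrib)
  have "(\<Prod>g\<leftarrow>g # gs. kfun p g ((of_int a * \<tau> + of_int b) / j)) =
     kfun p g ((of_int a * \<tau> + of_int b) / j) * (\<Prod>g\<leftarrow>gs. kfun p g ((of_int a * \<tau> + of_int b) / j))"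
    by simp
  also note Cons.IH
  also note kfun_modular[OF p \<tau> det c, of g, folded j_def]
  finally show ?case
    unfolding e by (simp add: mult_ac)
qed simp

text \<open>The extra factor in the denominator leaves one power of \<open>j\<close>, which cancels
  the weight factor of \<open>diamond 1\<close>. The roots of unity combine to exp(\<pi> i l), and
  \<open>l\<close> is an integer because \<open>p\<close> divides the signed sum of squares.\<close>

lemma diamond_kprod:
  assumes p: "p > 0" and \<gamma>: "\<gamma> \<in> carrier (Gamma0 p)"
    and len: "length ds = Suc (length ns)"
    and sq: "int p dvd (\<Sum>g\<leftarrow>ns. g ^ 2) - (\<Sum>g\<leftarrow>ds. g ^ 2)"
  shows "eq_upto_sign (diamond 1 \<gamma> (kprod p ns ds))
           (kprod p (map ((*) (\<gamma> $ 1 $ 1)) ns) (map ((*) (\<gamma> $ 1 $ 1)) ds))"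
proof -
  define a b c d where "a = \<gamma> $ 1 $ 1" "b = \<gamma> $ 1 $ 2" "c = \<gamma> $ 2 $ 1" "d = \<gamma> $ 2 $ 2"
  note abcd = this
  have det: "a * d - b * c = 1" and c: "int p dvd c"
    using \<gamma> by (auto simp: Gamma0_def det_2 abcd cong_0_iff)
  obtain k where k: "(\<Sum>g\<leftarrow>ns. g ^ 2) - (\<Sum>g\<leftarrow>ds. g ^ 2) = int p * k"
    using sq by blast
  define l where "l = b * (sum_list ns - sum_list ds) + a * b * k"
  have k': "(\<Sum>g\<leftarrow>ns. g ^ 2) = (\<Sum>g\<leftarrow>ds. g ^ 2) + int p * k"
    using k by simp
  have e: "exp (pi * \<i> * (of_int (b * sum_list ns) + of_int (a * b * (\<Sum>g\<leftarrow>ns. g ^ 2)) / of_nat p)) =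
    exp (pi * \<i> * of_int l) *
    exp (pi * \<i> * (of_int (b * sum_list ds) + of_int (a * b * (\<Sum>g\<leftarrow>ds. g ^ 2)) / of_nat p))"
    unfolding exp_add[symmetric] k'
    by (rule arg_cong[of _ _ exp]) (use p in \<open>simp add: l_def algebra_simps add_divide_distrib\<close>)
  have "exp (pi * \<i> * of_int l) = 1 \<or> exp (pi * \<i> * of_int l) = (- 1 :: complex)"
  proof (cases "even l")
    case True
    then obtain m where "l = 2 * m" by blast
    then show ?thesis
      using exp_integer_2pi[of "of_int m"] by (simp add: mult_ac)
  next
    case False
    then obtain m where "l = 2 * m + 1" by (rule oddE)
    then show ?thesis
      using exp_integer_2pi[of "of_int m"] by (simp add: distrib_left exp_add mult_ac)
  qed
  then show ?thesis
  proof (rule eq_upto_signI)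
    fix \<tau> :: complex
    assume \<tau>: "Im \<tau> > 0"
    define j where "j = of_int c * \<tau> + of_int d"
    have j: "j \<noteq> 0"
      using Im_moebius_pos(1)[OF \<tau> det] by (simp add: j_def)
    have "diamond 1 \<gamma> (kprod p ns ds) \<tau> = inverse j * kprod p ns ds ((of_int a * \<tau> + of_int b) / j)"
      by (simp add: diamond_def moebius_def abcd j_def power_int_minus)
    also have "\<dots> = exp (pi * \<i> * of_int l) * kprod p (map ((*) a) ns) (map ((*) a) ds) \<tau>"
      unfolding kprod_def prod_list_kfun_modular[OF p \<tau> det c, folded j_def] e len
      using j by (simp add: o_def field_simps)
    finally show "diamond 1 \<gamma> (kprod p ns ds) \<tau> = exp (pi * \<i> * of_int l) *
        kprod p (map ((*) (\<gamma> $ 1 $ 1)) ns) (map ((*) (\<gamma> $ 1 $ 1)) ds) \<tau>"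
      by (simp add: abcd)
  qed
qed

section \<open>Translation of Klein form quotients into infinite products\<close>

definition theta_block :: "nat \<Rightarrow> nat \<Rightarrow> complex \<Rightarrow> complex"
  where "theta_block p g q = qprod (q ^ g) (q ^ p) * qprod (q ^ (p - g)) (q ^ p)"

text \<open>Each \<open>kfun\<close> carries the inverse square of
  \<open>qprod (q ^ p) (q ^ p)\<close>. For a denominator list one longer than the numerator list
  exactly one such square is left, the pair q^p, q^p in the listed functions.\<close>

definition theta_quot :: "nat \<Rightarrow> nat \<Rightarrow> nat list \<Rightarrow> nat list \<Rightarrow> complex \<Rightarrow> complex"
  where "theta_quot p N ns ds q = q ^ N * qprod (q ^ p) (q ^ p) ^ 2 *
    (\<Prod>g\<leftarrow>ns. theta_block p g q) / (\<Prod>g\<leftarrow>ds. theta_block p g q)"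

lemma kfun_eq_theta_block:
  assumes "p > 0" "g \<le> p"
  shows "kfun p (int g) \<tau> = exp (pi * \<i> * of_int ((int g)\<^sup>2 - int p * int g) * \<tau> / of_nat p) *
    theta_block p g (cis2pi \<tau>) / qprod (cis2pi \<tau> ^ p) (cis2pi \<tau> ^ p) ^ 2"
proof -
  have "cis2pi (of_nat p * \<tau>) / cis2pi (of_nat g * \<tau>) = cis2pi \<tau> ^ (p - g)"
    unfolding cis2pi_of_nat_mult using assms by (simp add: power_diff)
  moreover have "exp (pi * \<i> * of_int ((int g)\<^sup>2) * \<tau> / of_nat p) * exp (- (pi * \<i> * (of_nat g * \<tau>))) =
      exp (pi * \<i> * of_int ((int g)\<^sup>2 - int p * int g) * \<tau> / of_nat p)"
    unfolding exp_add[symmetric]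
    by (rule arg_cong[of _ _ exp]) (use assms in \<open>simp add: field_simps\<close>)
  ultimately show ?thesis
    unfolding kfun_def ntheta_def of_int_of_nat_eq theta_block_def
    by (simp add: cis2pi_of_nat_mult flip: mult.assoc)
qed

lemma prod_list_kfun_eq_theta_block:
  assumes "p > 0" "\<forall>g\<in>set gs. g \<le> p"
  shows "(\<Prod>g\<leftarrow>map int gs. kfun p g \<tau>) =
    exp (pi * \<i> * of_int (\<Sum>g\<leftarrow>gs. (int g)\<^sup>2 - int p * int g) * \<tau> / of_nat p) *
    (\<Prod>g\<leftarrow>gs. theta_block p g (cis2pi \<tau>)) / qprod (cis2pi \<tau> ^ p) (cis2pi \<tau> ^ p) ^ (2 * length gs)"
  using assms(2)
proof (induction gs)
  case (Cons g gs)
  have "exp (pi * \<i> * of_int (\<Sum>g\<leftarrow>g # gs. (int g)\<^sup>2 - int p * int g) * \<tau> / of_nat p) =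
     exp (pi * \<i> * of_int ((int g)\<^sup>2 - int p * int g) * \<tau> / of_nat p) *
     exp (pi * \<i> * of_int (\<Sum>g\<leftarrow>gs. (int g)\<^sup>2 - int p * int g) * \<tau> / of_nat p)"
    unfolding exp_add[symmetric] by (rule arg_cong[of _ _ exp]) (simp add: ring_distribs add_divide_distrib diff_divide_distrib)
  with Cons show ?case
    by (simp add: kfun_eq_theta_block[OF assms(1)] power_add power2_eq_square mult_ac)
qed simp

text \<open>A Klein form of index \<open>g\<close> contributes q to the power (g^2 - p g)/(2 p); the
  hypothesis on the sums says that these fractional exponents add up to \<open>N\<close>.\<close>

lemma kprod_eq_theta_quot:
  assumes p: "p > 0" and le: "\<forall>g\<in>set ns \<union> set ds. g \<le> p" and len: "length ds = Suc (length ns)"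
    and N: "(\<Sum>g\<leftarrow>ns. (int g)\<^sup>2 - int p * int g) = (\<Sum>g\<leftarrow>ds. (int g)\<^sup>2 - int p * int g) + 2 * int p * int N"
    and \<tau>: "Im \<tau> > 0"
  shows "kprod p (map int ns) (map int ds) \<tau> = theta_quot p N ns ds (cis2pi \<tau>)"
proof -
  have "exp (pi * \<i> * of_int (\<Sum>g\<leftarrow>ns. (int g)\<^sup>2 - int p * int g) * \<tau> / of_nat p) =
     exp (pi * \<i> * of_int (\<Sum>g\<leftarrow>ds. (int g)\<^sup>2 - int p * int g) * \<tau> / of_nat p) * cis2pi (of_nat N * \<tau>)"
    unfolding N exp_add[symmetric] cis2pi_def
    by (rule arg_cong[of _ _ exp]) (use p in \<open>simp add: field_simps\<close>)
  moreover have "qprod (cis2pi \<tau> ^ p) (cis2pi \<tau> ^ p) \<noteq> 0"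
    using qprod_cis2pi_nonzero[of "of_nat p * \<tau>"] p \<tau> by (simp add: cis2pi_of_nat_mult)
  ultimately show ?thesis
    using le unfolding kprod_def
    by (simp add: prod_list_kfun_eq_theta_block[OF p] theta_quot_def len cis2pi_of_nat_mult power2_eq_square power_add
       del: map_map)
qed

section \<open>Behaviour at the cusp q = 0\<close>

lemma norm_qprod_minus_1:
  assumes "norm q \<le> 1 / 2"
  shows "norm (qprod w q - 1) \<le> exp (2 * norm w) - 1"
proof (rule tendsto_upperbound)
  show "(\<lambda>n. norm ((\<Prod>j<n. 1 - w * q ^ j) - 1)) \<longlonglongrightarrow> norm (qprod w q - 1)"
    by (intro tendsto_intros tendsto_qprod) (use assms in simp)
  have "norm ((\<Prod>j<n. 1 - w * q ^ j) - 1) \<le> exp (2 * norm w) - 1" for n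
  proof -
    \<comment> \<open>The geometric series is at most twice \<open>norm w\<close> for all admissible
      \<open>q\<close>, so the bound is uniform in \<open>q\<close> and allows \<open>w\<close> and
      \<open>q\<close> to tend to 0 together.\<close>
    have "norm ((\<Prod>j<n. 1 + - (w * q ^ j)) - 1) \<le> (\<Prod>j<n. 1 + norm (- (w * q ^ j))) - 1"
      by (rule norm_prod_minus1_le_prod_minus1)
    also have "(\<Prod>j<n. 1 + norm (- (w * q ^ j))) \<le> exp (\<Sum>j<n. norm (- (w * q ^ j)))"
      by (rule prod_le_exp_sum) simp
    also have "(\<Sum>j<n. norm (- (w * q ^ j))) \<le> (\<Sum>j. norm (w * q ^ j))"
      using assms summable_norm_geometric_mult[of q w] by (simp only: norm_minus_cancel) (rule sum_le_suminf; simp)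
    also have "\<dots> = norm w * (1 / (1 - norm q))"
      using assms by (simp add: norm_mult norm_power suminf_mult summable_geometric suminf_geometric)
    also have "\<dots> \<le> norm w * 2"
      using assms by (intro mult_left_mono) (auto simp: field_simps)
    finally show ?thesis by (simp add: mult.commute)
  qed
  then show "\<forall>\<^sub>F n in sequentially. norm ((\<Prod>j<n. 1 - w * q ^ j) - 1) \<le> exp (2 * norm w) - 1"
    by simp
qed simp

lemma tendsto_qprod_1:
  assumes "(w \<longlongrightarrow> 0) F" "(q \<longlongrightarrow> 0) F"
  shows "((\<lambda>x. qprod (w x) (q x)) \<longlongrightarrow> 1) F"
proof -
  have "((\<lambda>x. qprod (w x) (q x) - 1) \<longlongrightarrow> 0) F"
  proof (rule Lim_null_comparison)
    have "\<forall>\<^sub>F x in F. norm (q x) < 1 / 2"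
      using tendstoD[OF assms(2), of "1 / 2"] by simp
    then show "\<forall>\<^sub>F x in F. norm (qprod (w x) (q x) - 1) \<le> exp (2 * norm (w x)) - 1"
      by eventually_elim (simp add: norm_qprod_minus_1)
    have "((\<lambda>x. exp (2 * norm (w x)) - 1) \<longlongrightarrow> exp (2 * norm (0 :: complex)) - 1) F"
      by (intro tendsto_intros assms)
    then show "((\<lambda>x. exp (2 * norm (w x)) - 1) \<longlongrightarrow> 0) F"
      by simp
  qed
  then show ?thesis
    by (simp add: LIM_zero_iff)
qed

lemma tendsto_theta_quot:
  assumes q: "(q \<longlongrightarrow> 0) F" and p: "p > 0" and lt: "\<forall>g\<in>set ns \<union> set ds. 0 < g \<and> g < p"
  shows "((\<lambda>x. theta_quot p N ns ds (q x)) \<longlongrightarrow> (if N = 0 then 1 else 0)) F"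
proof -
  have pow: "((\<lambda>x. q x ^ k) \<longlongrightarrow> 0) F" if "k > 0" for k
    using tendsto_power[OF q, of k] that by (simp add: zero_power)
  have block: "((\<lambda>x. \<Prod>g\<leftarrow>gs. theta_block p g (q x)) \<longlongrightarrow> 1) F" if "\<forall>g\<in>set gs. 0 < g \<and> g < p" for gs
    using that
  proof (induction gs)
    case (Cons g gs)
    have "((\<lambda>x. theta_block p g (q x) * (\<Prod>g\<leftarrow>gs. theta_block p g (q x))) \<longlongrightarrow> (1 * 1) * 1) F"
      unfolding theta_block_def[of p g]
      by (intro tendsto_mult tendsto_qprod_1 pow p Cons.IH) (use Cons.prems in auto)
    then show ?case by simp
  qed simp
  \<comment> \<open>Strictness in 0 < g < p makes all exponents in the blocks positive, so each
    block tends to 1; \<open>0 ^ N\<close> produces the case distinction since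
    \<open>0 ^ 0 = 1\<close>.\<close>
  have "((\<lambda>x. theta_quot p N ns ds (q x)) \<longlongrightarrow> 0 ^ N * 1 ^ 2 * 1 / 1) F"
    unfolding theta_quot_def
    by (intro tendsto_mult tendsto_divide tendsto_power tendsto_qprod_1 pow p block q) (use lt in auto)
  then show ?thesis
    by (simp add: power_0_left)
qed

text \<open>Along the positive imaginary axis q tends to 0, where the norm of one quotient tends to
  1 and that of the other to 0; norms do not see the sign.\<close>

lemma theta_quot_not_eq_upto_sign:
  assumes p: "p > 0" and lt: "\<forall>g\<in>set ns \<union> set ds \<union> set ns' \<union> set ds'. 0 < g \<and> g < p" and N: "N > 0"
  shows "\<not> eq_upto_sign (\<lambda>\<tau>. theta_quot p 0 ns ds (cis2pi \<tau>)) (\<lambda>\<tau>. theta_quot p N ns' ds' (cis2pi \<tau>))"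
proof
  assume eq: "eq_upto_sign (\<lambda>\<tau>. theta_quot p 0 ns ds (cis2pi \<tau>)) (\<lambda>\<tau>. theta_quot p N ns' ds' (cis2pi \<tau>))"
  define q where "q = (\<lambda>t. cis2pi (\<i> * of_real t))"
  have "((\<lambda>t. norm (q t)) \<longlongrightarrow> 0) at_top"
    unfolding q_def norm_cis2pi by simp real_asymp
  then have q: "(q \<longlongrightarrow> 0) at_top"
    by (rule tendsto_norm_zero_cancel)
  have 1: "((\<lambda>t. norm (theta_quot p 0 ns ds (q t))) \<longlongrightarrow> norm (1 :: complex)) at_top"
    using tendsto_norm[OF tendsto_theta_quot[OF q p, of ns ds 0]] lt by simp
  have 2: "((\<lambda>t. norm (theta_quot p N ns' ds' (q t))) \<longlongrightarrow> norm (0 :: complex)) at_top"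
    using tendsto_norm[OF tendsto_theta_quot[OF q p, of ns' ds' N]] lt N by simp
  have "\<forall>\<^sub>F t in at_top. norm (theta_quot p 0 ns ds (q t)) = norm (theta_quot p N ns' ds' (q t))"
    using eventually_gt_at_top[of 0]
  proof eventually_elim
    fix t :: real
    assume "t > 0"
    then have "\<i> * of_real t \<in> upper_half_plane"
      by (simp add: upper_half_plane_def)
    with eq show "norm (theta_quot p 0 ns ds (q t)) = norm (theta_quot p N ns' ds' (q t))"
      by (auto simp: eq_upto_sign_def q_def)
  qed
  with 1 have 3: "((\<lambda>t. norm (theta_quot p N ns' ds' (q t))) \<longlongrightarrow> norm (1 :: complex)) at_top"
    by (rule Lim_transform_eventually)
  have "norm (0 :: complex) = norm (1 :: complex)"
    by (rule tendsto_unique[OF _ 2 3]) simp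
  then show False by simp
qed

section \<open>The functions \<open>x\<^sub>i\<close> as theta quotients\<close>

text \<open>
  An entry \<open>(u, N, ns, ds)\<close> at position \<open>i\<close> describes \<open>x\<^sub>i\<close> as \<open>\<plusminus> theta_quot p N ns ds\<close>; the lists \<open>ns\<close> and
  \<open>ds\<close> arise from those of \<open>x\<^sub>1\<close> by multiplying by \<open>u\<close> and reducing modulo \<open>p\<close> and sign into
  \<open>{1..(p - 1) / 2}\<close>.
\<close>

definition level_data :: "nat \<Rightarrow> (nat \<times> nat \<times> nat list \<times> nat list) list" where
  "level_data p =
    (if p = 5 then
       [(1, 0, [2, 2], [1, 1, 1]),
        (2, 1, [1, 1], [2, 2, 2])]
     else if p = 7 then
       [(1, 0, [3], [1, 1]),
        (3, 1, [2], [3, 3]),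
        (2, 1, [1], [2, 2])]
     else if p = 11 then
       [(1, 0, [4], [1, 2]),
        (4, 1, [5], [4, 3]),
        (3, 2, [1], [3, 5]),
        (2, 1, [3], [2, 4]),
        (5, 1, [2], [5, 1])]
     else if p = 13 then
       [(1, 0, [6], [1, 3]),
        (3, 1, [5], [3, 4]),
        (4, 1, [2], [4, 1]),
        (5, 1, [4], [5, 2]),
        (6, 2, [3], [6, 5]),
        (2, 2, [1], [2, 6])]
     else if p = 17 then
       [(1, 0, [8], [2, 3]),
        (7, 1, [5], [3, 4]),
        (2, 3, [1], [4, 6]),
        (3, 2, [7], [6, 8]),
        (4, 3, [2], [8, 5]),
        (6, 1, [3], [5, 1]),
        (8, 1, [4], [1, 7]),
        (5, 1, [6], [7, 2])]
     else if p = 19 then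
       [(1, 0, [8, 9], [3, 4, 5]),
        (5, 1, [2, 7], [4, 1, 6]),
        (6, 1, [9, 3], [1, 5, 8]),
        (8, 1, [7, 4], [5, 6, 2]),
        (2, 5, [3, 1], [6, 8, 9]),
        (9, 2, [4, 5], [8, 2, 7]),
        (7, 2, [1, 6], [2, 9, 3]),
        (3, 2, [5, 8], [9, 7, 4]),
        (4, 1, [6, 2], [7, 3, 1])]
     else [])"

text \<open>The factors are grouped by the residue of their index modulo \<open>m\<close>, which on
  the level of partial products is the subsequence of lengths \<open>n * m\<close>. This serves the
  factor (q;q) in level 5.\<close>

lemma qprod_split:
  assumes q: "norm q < 1" and m: "m > 0"
  shows "qprod w q = (\<Prod>r<m. qprod (w * q ^ r) (q ^ m))"
proof (rule LIMSEQ_unique)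
  have qm: "norm (q ^ m) < 1"
    using q m by (simp add: norm_power power_less_one_iff)
  show "(\<lambda>n. \<Prod>j<n * m. 1 - w * q ^ j) \<longlonglongrightarrow> qprod w q"
    using LIMSEQ_subseq_LIMSEQ[OF tendsto_qprod[OF q], of "\<lambda>n. n * m"] m
    by (simp add: o_def strict_mono_def)
  have "(\<Prod>j<n * m. 1 - w * q ^ j) = (\<Prod>r<m. \<Prod>j<n. 1 - w * q ^ r * (q ^ m) ^ j)" for n
  proof -
    have "(\<Prod>j<n * m. 1 - w * q ^ j) = (\<Prod>j<n. \<Prod>i = j * m..<j * m + m. 1 - w * q ^ i)"
      by (rule prod.nat_group[symmetric])
    also have "\<dots> = (\<Prod>j<n. \<Prod>r<m. 1 - w * q ^ r * (q ^ m) ^ j)"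
    proof (rule prod.cong[OF refl])
      fix j
      have "(\<Prod>i = j * m..<j * m + m. 1 - w * q ^ i) = (\<Prod>r = 0..<m. 1 - w * q ^ (r + j * m))"
        using prod.shift_bounds_nat_ivl[of "\<lambda>i. 1 - w * q ^ i" 0 "j * m" m] by (simp add: add.commute)
      also have "\<dots> = (\<Prod>r<m. 1 - w * q ^ r * (q ^ m) ^ j)"
        by (intro prod.cong) (auto simp: power_add power_mult[symmetric] mult.commute[of j])
      finally show "(\<Prod>i = j * m..<j * m + m. 1 - w * q ^ i) = (\<Prod>r<m. 1 - w * q ^ r * (q ^ m) ^ j)" .
    qed
    also have "\<dots> = (\<Prod>r<m. \<Prod>j<n. 1 - w * q ^ r * (q ^ m) ^ j)"
      by (rule prod.swap)
    finally show ?thesis .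
  qed
  then show "(\<lambda>n. \<Prod>j<n * m. 1 - w * q ^ j) \<longlonglongrightarrow> (\<Prod>r<m. qprod (w * q ^ r) (q ^ m))"
    using qm by (simp only:) (intro tendsto_prod tendsto_qprod)
qed

text \<open>Splitting (q;q) by residues modulo 5 gives both theta blocks times (q^5;q^5). Its square
  cancels two of the five blocks in the denominator and leaves two blocks of the other kind
  above.\<close>

lemma level_fns_5:
  assumes "norm q < 1"
  shows "level_fns 5 q = map (\<lambda>(u, N, ns, ds). theta_quot 5 N ns ds q) (level_data 5)"
proof -
  define A B E where "A = theta_block 5 1 q" "B = theta_block 5 2 q" "E = qprod (q ^ 5) (q ^ 5)"
  note defs = this
  have "{..<5::nat} = {0, 1, 2, 3, 4}"
    by auto
  then have "qprod q q = A * B * E"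
    unfolding qprod_split[OF assms, of 5 q, simplified]
    by (simp add: defs theta_block_def mult_ac flip: power_Suc numeral_2_eq_2)
  then have "level_fns 5 q = [(A * B * E) ^ 2 / A ^ 5, q * (A * B * E) ^ 2 / B ^ 5]"
    by (simp add: level_fns_def defs theta_block_def)
  moreover have "map (\<lambda>(u, N, ns, ds). theta_quot 5 N ns ds q) (level_data 5) =
      [E ^ 2 * (B * B) / (A * (A * A)), q * E ^ 2 * (A * A) / (B * (B * B))]"
    by (simp add: level_data_def theta_quot_def defs)
  \<comment> \<open>For \<open>x = 0\<close> both sides are 0 by the convention for division by
    zero, so the blocks need not be shown nonzero.\<close>
  moreover have "(x * y * E) ^ 2 / x ^ 5 = E ^ 2 * (y * y) / (x * (x * x))" for x y
    by (cases "x = 0") (simp_all add: field_simps eval_nat_numeral)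
  from this[of A B] this[of B A]
  have "(A * B * E) ^ 2 / A ^ 5 = E ^ 2 * (B * B) / (A * (A * A))"
    "q * (A * B * E) ^ 2 / B ^ 5 = q * E ^ 2 * (A * A) / (B * (B * B))"
    by (simp_all add: mult_ac flip: times_divide_eq_right)
  ultimately show ?thesis
    by simp
qed

lemma level_fns_7:
  "level_fns 7 q = map2 (*) [1, 1, - 1] (map (\<lambda>(u, N, ns, ds). theta_quot 7 N ns ds q) (level_data 7))"
  by (simp add: level_fns_def level_data_def theta_quot_def theta_block_def power2_eq_square mult_ac)

lemma level_fns_ge_11:
  assumes "p \<in> {11, 13, 17, 19}"
  shows "level_fns p q = map (\<lambda>(u, N, ns, ds). theta_quot p N ns ds q) (level_data p)"
proof -
  have "\<forall>p\<in>{11, 13, 17, 19}. level_fns p q = map (\<lambda>(u, N, ns, ds). theta_quot p N ns ds q) (level_data p)"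
    by (simp add: level_fns_def level_data_def theta_quot_def theta_block_def power2_eq_square mult_ac)
  with assms show ?thesis by blast
qed

text \<open>The conditions of \<open>kprod_eq_theta_quot\<close>, with the bounds 0 < g < p required
  for the limit at the cusp, and the relation to the first entry. \<open>list_all2\<close> compares
  position by position, which dictates the unsorted order of the lists in
  \<open>level_data\<close>.\<close>

definition level_entry :: "nat \<Rightarrow> nat list \<Rightarrow> nat list \<Rightarrow> nat \<times> nat \<times> nat list \<times> nat list \<Rightarrow> bool" where
  "level_entry p ns0 ds0 = (\<lambda>(u, N, ns, ds).
     length ds = Suc (length ns) \<and> (\<forall>g\<in>set ns \<union> set ds. 0 < g \<and> g < p) \<and>
     (\<Sum>g\<leftarrow>ns. (int g)\<^sup>2 - int p * int g) = (\<Sum>g\<leftarrow>ds. (int g)\<^sup>2 - int p * int g) + 2 * int p * int N \<and>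
     list_all2 (cong_pm p) (map (\<lambda>g. int u * int g) ns0) (map int ns) \<and>
     list_all2 (cong_pm p) (map (\<lambda>g. int u * int g) ds0) (map int ds))"

lemma level_data_valid:
  assumes "p \<in> {5, 7, 11, 13, 17, 19}"
  obtains ns0 ds0 rest where "level_data p = (1, 0, ns0, ds0) # rest" "\<forall>(u, N, ns, ds)\<in>set rest. N > 0"
    "length rest = (p - 1) div 2 - 1" "fst ` set (level_data p) = {1..(p - 1) div 2}"
    "\<forall>x\<in>set (level_data p). level_entry p ns0 ds0 x"
    "int p dvd (\<Sum>g\<leftarrow>ns0. (int g)\<^sup>2) - (\<Sum>g\<leftarrow>ds0. (int g)\<^sup>2)"
proof -
  \<comment> \<open>All requirements are gathered in one decidable predicate, so that the six tables
    are verified by evaluation.\<close>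
  define ok where "ok p \<longleftrightarrow> (case level_data p of [] \<Rightarrow> False | (u, N, ns0, ds0) # rest \<Rightarrow>
      u = 1 \<and> N = 0 \<and> (\<forall>(u, N, ns, ds)\<in>set rest. N > 0) \<and> length rest = (p - 1) div 2 - 1 \<and>
      fst ` set (level_data p) = {1..(p - 1) div 2} \<and>
      (\<forall>x\<in>set (level_data p). level_entry p ns0 ds0 x) \<and>
      int p dvd (\<Sum>g\<leftarrow>ns0. (int g)\<^sup>2) - (\<Sum>g\<leftarrow>ds0. (int g)\<^sup>2))" for p
  have "\<forall>p\<in>{5, 7, 11, 13, 17, 19}. ok p"
    unfolding ok_def by code_simp
  with assms have "ok p" by blast
  then show thesis
    using that by (auto simp: ok_def split: list.splits)
qed

lemma xfun_eq_theta_quot: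
  assumes p: "p \<in> {5, 7, 11, 13, 17, 19}" and i: "i \<in> {1..(p - 1) div 2}"
    and entry: "level_data p ! (i - 1) = (u, N, ns, ds)"
  shows "eq_upto_sign (xfun p i) (\<lambda>\<tau>. theta_quot p N ns ds (cis2pi \<tau>))"
proof -
  have len: "i - 1 < length (level_data p)"
    using i by (rule_tac level_data_valid[OF p]) auto
  have *: "eq_upto_sign (xfun p i) (\<lambda>\<tau>. theta_quot p N ns ds (cis2pi \<tau>))"
    if "\<And>q. norm q < 1 \<Longrightarrow> level_fns p q = map (\<lambda>(u, N, ns, ds). theta_quot p N ns ds q) (level_data p)"
    by (rule eq_upto_signI[of 1]) (use len entry in \<open>simp_all add: xfun_def that flip: cis2pi_def\<close>)
  consider "p = 5" | "p = 7" | "p \<in> {11, 13, 17, 19}"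
    using p by auto
  then show ?thesis
  proof cases
    case 1
    show ?thesis by (rule *) (simp add: 1 level_fns_5)
  next
    case 3
    show ?thesis by (rule *) (rule level_fns_ge_11[OF 3])
  next
    case 2
    have len7: "i - 1 < 3"
      using i 2 by auto
    \<comment> \<open>The explicit minus sign of the third function of level 7 is the only sign by
      which a listed function differs from its theta quotient.\<close>
    define \<epsilon> :: complex where "\<epsilon> = [1, 1, - 1] ! (i - 1)"
    have "\<epsilon> = 1 \<or> \<epsilon> = - 1"
      using len7 by (auto simp: \<epsilon>_def less_Suc_eq numeral_3_eq_3)
    moreover have "xfun p i \<tau> = \<epsilon> * theta_quot p N ns ds (cis2pi \<tau>)" for \<tau>
      using len len7 entry unfolding xfun_def 2 level_fns_7 cis2pi_def[symmetric] \<epsilon>_def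
      by (subst nth_map) auto
    ultimately show ?thesis
      by (rule eq_upto_signI)
  qed
qed

text \<open>The interface between the explicit tables and the group action: one Klein form quotient
  scaled by labels \<open>u i\<close>, with the labels a permutation of the index range. The last
  clause comes from the tables having N = 0 in the first entry alone, by the limit at the
  cusp.\<close>

lemma level_family:
  assumes p: "p \<in> {5, 7, 11, 13, 17, 19}"
  obtains ds ns u where "length ds = Suc (length ns)" "int p dvd (\<Sum>g\<leftarrow>ns. g\<^sup>2) - (\<Sum>g\<leftarrow>ds. g\<^sup>2)"
    "bij_betw u {1..(p - 1) div 2} {1..(p - 1) div 2}" "u 1 = 1"
    "\<forall>i\<in>{1..(p - 1) div 2}.
       eq_upto_sign (xfun p i) (kprod p (map ((*) (int (u i))) ns) (map ((*) (int (u i))) ds))"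
    "\<forall>i\<in>{1..(p - 1) div 2}. eq_upto_sign (xfun p i) (xfun p 1) \<longrightarrow> i = 1"
proof -
  obtain ns0 ds0 rest where data: "level_data p = (1, 0, ns0, ds0) # rest"
    and rest: "\<forall>(u, N, ns, ds)\<in>set rest. N > 0" "length rest = (p - 1) div 2 - 1"
    and fst: "fst ` set (level_data p) = {1..(p - 1) div 2}"
    and entry: "\<forall>x\<in>set (level_data p). level_entry p ns0 ds0 x"
    and dvd: "int p dvd (\<Sum>g\<leftarrow>ns0. (int g)\<^sup>2) - (\<Sum>g\<leftarrow>ds0. (int g)\<^sup>2)"
    by (rule level_data_valid[OF p])
  define n where "n = (p - 1) div 2"
  have n: "n > 0" and p0: "p > 0"
    using p by (auto simp: n_def)
  have len: "length (level_data p) = n"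
    using rest(2) n by (simp add: data n_def)
  have lt: "\<forall>g\<in>set ns \<union> set ds. 0 < g \<and> g < p" if "(u, N, ns, ds) \<in> set (level_data p)" for u N ns ds
    using entry that by (auto simp: level_entry_def)
  define u where "u = (\<lambda>i. fst (level_data p ! (i - 1)))"
  have mem: "level_data p ! (i - 1) \<in> set (level_data p)" if "i \<in> {1..n}" for i
    by (rule nth_mem) (use that len in auto)
  have "u ` {1..n} = fst ` set (level_data p)"
  proof -
    have "u ` {1..n} = (\<lambda>i. fst (level_data p ! i)) ` {..<n}"
      unfolding image_Suc_lessThan[symmetric] by (simp add: image_image u_def)
    also have "(\<lambda>i. fst (level_data p ! i)) ` {..<n} = fst ` set (level_data p)"
      by (auto simp: set_conv_nth len image_iff)
    finally show ?thesis .
  qed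
  then have u_img: "u ` {1..n} = {1..n}"
    using fst by (simp add: n_def)
  have entry0: "level_entry p ns0 ds0 (1, 0, ns0, ds0)"
    using entry by (simp add: data)
  have family: "eq_upto_sign (xfun p i) (kprod p (map ((*) (int (u i))) (map int ns0)) (map ((*) (int (u i))) (map int ds0)))"
    and first: "eq_upto_sign (xfun p i) (xfun p 1) \<Longrightarrow> i = 1" if i: "i \<in> {1..n}" for i
  proof -
    obtain v N ns ds where e: "level_data p ! (i - 1) = (v, N, ns, ds)"
      by (cases "level_data p ! (i - 1)") auto
    have uv: "u i = v"
      unfolding u_def e by simp
    have ok: "level_entry p ns0 ds0 (v, N, ns, ds)"
      using entry mem[OF i] unfolding e by (rule bspec)
    have le: "\<forall>g\<in>set ns \<union> set ds. g \<le> p"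
      using ok by (auto simp: level_entry_def less_imp_le)
    have sums: "length ds = Suc (length ns)"
      "(\<Sum>g\<leftarrow>ns. (int g)\<^sup>2 - int p * int g) = (\<Sum>g\<leftarrow>ds. (int g)\<^sup>2 - int p * int g) + 2 * int p * int N"
      using ok by (simp_all add: level_entry_def)
    have 1: "eq_upto_sign (xfun p i) (\<lambda>\<tau>. theta_quot p N ns ds (cis2pi \<tau>))"
      using xfun_eq_theta_quot[OF p _ e] i by (simp add: n_def)
    also have "eq_upto_sign \<dots> (kprod p (map int ns) (map int ds))"
      by (rule eq_upto_signI[of 1]) (simp_all add: kprod_eq_theta_quot[OF p0 le sums])
    also have "eq_upto_sign \<dots> (kprod p (map ((*) (int (u i))) (map int ns0)) (map ((*) (int (u i))) (map int ds0)))"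
      by (rule eq_upto_sign_sym, rule kprod_cong_pm[OF p0])
        (use ok in \<open>simp_all add: level_entry_def uv o_def\<close>)
    finally show "eq_upto_sign (xfun p i) (kprod p (map ((*) (int (u i))) (map int ns0)) (map ((*) (int (u i))) (map int ds0)))" .
    show "i = 1" if eq: "eq_upto_sign (xfun p i) (xfun p 1)"
    proof (rule ccontr)
      assume "i \<noteq> 1"
      \<comment> \<open>Indices start at 1 and list positions at 0, so position \<open>i - 1\<close>
        of the table is position \<open>i - 2\<close> of \<open>rest\<close>.\<close>
      then have "(v, N, ns, ds) \<in> set rest"
        using i e len nth_mem[of "i - 2" rest] by (auto simp: data nth_Cons' numeral_2_eq_2)
      then have N: "N > 0" and mem': "(v, N, ns, ds) \<in> set (level_data p)"
        using rest(1) data by auto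
      have "eq_upto_sign (xfun p 1) (\<lambda>\<tau>. theta_quot p 0 ns0 ds0 (cis2pi \<tau>))"
        using xfun_eq_theta_quot[OF p, of 1 1 0 ns0 ds0] n by (simp add: n_def data)
      then have "eq_upto_sign (\<lambda>\<tau>. theta_quot p 0 ns0 ds0 (cis2pi \<tau>)) (\<lambda>\<tau>. theta_quot p N ns ds (cis2pi \<tau>))"
        using 1 eq eq_upto_sign_sym eq_upto_sign_trans by blast
      moreover have "\<forall>g\<in>set ns0 \<union> set ds0 \<union> set ns \<union> set ds. 0 < g \<and> g < p"
        using lt[OF mem'] lt[of 1 0 ns0 ds0] data by auto
      ultimately show False
        using theta_quot_not_eq_upto_sign[OF p0 _ N] by blast
    qed
  qed
  have "length (map int ds0) = Suc (length (map int ns0))"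
    using entry0 by (simp add: level_entry_def)
  moreover have "int p dvd (\<Sum>g\<leftarrow>map int ns0. g\<^sup>2) - (\<Sum>g\<leftarrow>map int ds0. g\<^sup>2)"
    using dvd by (simp add: o_def)
  moreover have "bij_betw u {1..n} {1..n}"
    using u_img eq_card_imp_inj_on[of "{1..n}" u] by (simp add: bij_betw_def)
  moreover have "u 1 = 1"
    by (simp add: u_def data)
  ultimately show thesis
    using that[of "map int ds0" "map int ns0" u] family first unfolding n_def by blast
qed

section \<open>The permutation representation\<close>

text \<open>By primality, \<open>p\<close> divides (a - b)(a + b) only if it divides a factor.
  Through squares, transitivity and multiplicativity of \<open>cong_pm\<close> are inherited from
  ordinary congruence.\<close>

lemma cong_pm_iff_squares:
  assumes "prime p"
  shows "cong_pm p a b \<longleftrightarrow> [a\<^sup>2 = b\<^sup>2] (mod int p)"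
proof -
  have "[a\<^sup>2 = b\<^sup>2] (mod int p) \<longleftrightarrow> int p dvd (a - b) * (a + b)"
    by (simp add: cong_iff_dvd_diff power2_eq_square algebra_simps)
  also have "\<dots> \<longleftrightarrow> int p dvd a - b \<or> int p dvd a - - b"
    using assms by (simp add: prime_dvd_mult_iff)
  finally show ?thesis
    by (simp add: cong_pm_def cong_iff_dvd_diff)
qed

lemma cong_pm_refl [simp]: "cong_pm p a a"
  by (simp add: cong_pm_def)

lemma cong_pm_sym: "prime p \<Longrightarrow> cong_pm p a b \<Longrightarrow> cong_pm p b a"
  by (simp add: cong_pm_iff_squares cong_sym)

lemma cong_pm_trans: "prime p \<Longrightarrow> cong_pm p a b \<Longrightarrow> cong_pm p b c \<Longrightarrow> cong_pm p a c"
  unfolding cong_pm_iff_squares by (rule cong_trans)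

lemma cong_pm_mult: "prime p \<Longrightarrow> cong_pm p a b \<Longrightarrow> cong_pm p c d \<Longrightarrow> cong_pm p (a * c) (b * d)"
  unfolding cong_pm_iff_squares power_mult_distrib by (rule cong_mult)

lemma cong_pm_minus [simp]: "cong_pm p (- a) b \<longleftrightarrow> cong_pm p a b"
  using cong_minus_minus_iff[of a "- b" "int p"] cong_minus_minus_iff[of a b "int p"]
  by (auto simp: cong_pm_def)

lemma cong_imp_cong_pm: "[a = b] (mod int p) \<Longrightarrow> cong_pm p a b"
  by (simp add: cong_pm_def)

lemma cong_pm_cancel_unit:
  assumes p: "prime p" and vw: "[v * w = 1] (mod int p)" and c: "cong_pm p (a * v) (b * v)"
  shows "cong_pm p a b"
proof -
  have e: "cong_pm p (x * v * w) x" for x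
    using cong_mult[OF cong_refl[of x] vw] by (simp add: cong_imp_cong_pm mult.assoc)
  have "cong_pm p (a * v * w) (b * v * w)"
    by (rule cong_pm_mult[OF p c]) simp
  then show ?thesis
    using e[of a] e[of b] cong_pm_sym[OF p] cong_pm_trans[OF p] by blast
qed

lemma inverse_mod_prime:
  assumes "coprime v (int p)"
  obtains w where "[v * w = 1] (mod int p)" "coprime w (int p)"
proof -
  obtain w where w: "[v * w = 1] (mod int p)"
    using cong_solve_coprime_int[OF assms] by blast
  then have "coprime (v * w) (int p)"
    by (metis cong_imp_coprime cong_sym coprime_1_left)
  with w show thesis
    by (intro that) auto
qed

text \<open>With p = 2 n + 1 and \<open>k\<close> the least residue of \<open>v\<close>, either
  \<open>k\<close> or \<open>p - k\<close> lies in \<open>{1..n}\<close>. Two representatives in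
  this range have sum and absolute difference below \<open>p\<close>, so they can be congruent up to
  sign only if equal.\<close>

lemma unique_representative_mod_pm:
  assumes p: "prime p" and p2: "p > 2" and v: "coprime v (int p)"
  shows "\<exists>!r. r \<in> {1..(p - 1) div 2} \<and> cong_pm p v (int r)"
proof -
  have odd: "odd p"
    using p p2 prime_odd_nat by auto
  then obtain n where n: "p = 2 * n + 1"
    by (rule oddE)
  have half: "(p - 1) div 2 = n"
    by (simp add: n)
  have "\<not> int p dvd v"
    using p v by (meson coprime_absorb_right coprime_commute not_prime_unit prime_nat_int_transfer)
  then obtain k where k: "v mod int p = k" "k \<noteq> 0" "0 \<le> k" "k < int p"
    using p2 by (auto simp: dvd_eq_mod_eq_0)
  have v_k: "[v = k] (mod int p)"
    by (simp add: cong_def flip: k(1))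
  have "\<exists>r. r \<in> {1..n} \<and> cong_pm p v (int r)"
  proof (cases "k \<le> int n")
    case True
    have "cong_pm p v (int (nat k))"
      using v_k k(3) by (simp add: cong_pm_def)
    moreover have "nat k \<in> {1..n}"
      using k True by (auto simp: Suc_le_eq)
    ultimately show ?thesis by blast
  next
    case False
    have "[v = - (int p - k)] (mod int p)"
      using v_k by (simp add: cong_def)
    then have "cong_pm p v (int (nat (int p - k)))"
      using k(4) by (simp add: cong_pm_def)
    moreover have "nat (int p - k) \<in> {1..n}"
      using k(4) False n by (auto simp: Suc_le_eq)
    ultimately show ?thesis by blast
  qed
  moreover have "r = s" if "r \<in> {1..n} \<and> cong_pm p v (int r)" "s \<in> {1..n} \<and> cong_pm p v (int s)" for r s
  proof -
    have "cong_pm p (int r) (int s)"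
      using that cong_pm_sym[OF p] cong_pm_trans[OF p] by blast
    then consider "int p dvd int r - int s" | "int p dvd int r + int s"
      by (auto simp: cong_pm_def cong_iff_dvd_diff)
    then show ?thesis
    proof cases
      case 1
      then show ?thesis
        using that n zdvd_imp_le[of "int p" "\<bar>int r - int s\<bar>"] by (cases "r = s") auto
    next
      case 2
      then show ?thesis
        using that n zdvd_imp_le[of "int p" "int r + int s"] by auto
    qed
  qed
  ultimately show ?thesis
    unfolding half by blast
qed

section \<open>The unit group modulo sign\<close>

lemma unit_class_eq: "unit_class p d = {d mod int p, (- d) mod int p}"
proof -
  have "(int p - 1) * (d mod int p) mod int p = (- d + int p * d) mod int p"
    unfolding mod_mult_right_eq by (simp add: algebra_simps)
  also have "\<dots> = (- d) mod int p"
    by (rule mod_mult_self2)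
  finally show ?thesis
    by (simp add: unit_class_def r_coset_def units_of_def residue_ring_def insert_commute)
qed

lemma unit_class_eq_iff: "unit_class p a = unit_class p b \<longleftrightarrow> cong_pm p a b"
proof
  assume "unit_class p a = unit_class p b"
  then have "a mod int p \<in> {b mod int p, (- b) mod int p}"
    unfolding unit_class_eq by blast
  then show "cong_pm p a b"
    by (auto simp: cong_pm_def cong_def)
next
  assume "cong_pm p a b"
  then consider "[a = b] (mod int p)" | "[a = - b] (mod int p)"
    by (auto simp: cong_pm_def)
  then show "unit_class p a = unit_class p b"
  proof cases
    case 1
    moreover have "[- a = - b] (mod int p)"
      using 1 by (simp add: cong_minus_minus_iff)
    ultimately show ?thesis
      by (simp add: unit_class_eq cong_def)
  next
    case 2
    moreover have "[- a = b] (mod int p)"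
      using 2 cong_minus_minus_iff[of a "- b" "int p"] by simp
    ultimately show ?thesis
      by (simp add: unit_class_eq cong_def insert_commute)
  qed
qed

lemma carrier_units_mod_pm:
  assumes "prime p"
  shows "carrier (units_mod_pm p) = {unit_class p d | d. coprime d (int p)}"
proof -
  interpret residues_prime p "residue_ring (int p)"
    using assms by unfold_locales simp_all
  have "carrier (units_mod_pm p) = (\<lambda>a. {1, int p - 1} #>\<^bsub>units_of (residue_ring (int p))\<^esub> a) ` Units (residue_ring (int p))"
    by (auto simp: units_mod_pm_def FactGroup_def RCOSETS_def units_of_carrier)
  also have "\<dots> = unit_class p ` Units (residue_ring (int p))"
    by (rule image_cong) (simp_all add: unit_class_def res_units_eq)
  also have "\<dots> = {unit_class p d | d. coprime d (int p)}"
  proof safe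
    fix d
    assume "d \<in> Units (residue_ring (int p))"
    then show "\<exists>d'. unit_class p d = unit_class p d' \<and> coprime d' (int p)"
      by (auto simp: res_units_eq)
  next
    fix d
    assume "coprime d (int p)"
    then have "d mod int p \<in> Units (residue_ring (int p))"
      by (intro mod_in_res_units m_gt_one)
    moreover have "unit_class p d = unit_class p (d mod int p)"
      by (simp add: unit_class_def)
    ultimately show "unit_class p d \<in> unit_class p ` Units (residue_ring (int p))"
      by blast
  qed
  finally show ?thesis .
qed

lemma mult_units_mod_pm:
  "unit_class p a \<otimes>\<^bsub>units_mod_pm p\<^esub> unit_class p b = unit_class p (a * b)"
  by (simp add: units_mod_pm_def FactGroup_def set_mult_def unit_class_eq units_of_def residue_ring_def
      mod_mult_eq insert_commute)

section \<open>Matrices in Gamma0(p) and the quotient by the sign\<close>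

lemma int_matrix_mult_2:
  fixes A B :: "int^2^2"
  shows "(A ** B) $ i $ j = A $ i $ 1 * B $ 1 $ j + A $ i $ 2 * B $ 2 $ j"
  by (simp add: matrix_matrix_mult_def sum_2)

lemma pm_I_coset: "pm_I #>\<^bsub>Gamma0 p\<^esub> \<gamma> = {\<gamma>, - \<gamma>}"
proof -
  have "(- mat 1) ** \<gamma> = - \<gamma>"
    by (simp add: vec_eq_iff int_matrix_mult_2 forall_2 mat_def)
  then show ?thesis
    by (simp add: r_coset_def Gamma0_def pm_I_def insert_commute)
qed

lemma Gamma0_mem_iff:
  "\<gamma> \<in> carrier (Gamma0 p) \<longleftrightarrow> \<gamma> $ 1 $ 1 * \<gamma> $ 2 $ 2 - \<gamma> $ 1 $ 2 * \<gamma> $ 2 $ 1 = 1 \<and> int p dvd \<gamma> $ 2 $ 1"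
  by (simp add: Gamma0_def det_2 cong_0_iff)

lemma Gamma0_diag:
  assumes "\<gamma> \<in> carrier (Gamma0 p)"
  shows "[\<gamma> $ 1 $ 1 * \<gamma> $ 2 $ 2 = 1] (mod int p)" and "coprime (\<gamma> $ 1 $ 1) (int p)" and "coprime (\<gamma> $ 2 $ 2) (int p)"
proof -
  have "\<gamma> $ 1 $ 1 * \<gamma> $ 2 $ 2 - 1 = \<gamma> $ 1 $ 2 * \<gamma> $ 2 $ 1" "int p dvd \<gamma> $ 2 $ 1"
    using assms by (auto simp: Gamma0_mem_iff)
  then show 1: "[\<gamma> $ 1 $ 1 * \<gamma> $ 2 $ 2 = 1] (mod int p)"
    by (simp add: cong_iff_dvd_diff)
  have "coprime (\<gamma> $ 1 $ 1 * \<gamma> $ 2 $ 2) (int p)"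
    using 1 by (metis cong_imp_coprime cong_sym coprime_1_left)
  then show "coprime (\<gamma> $ 1 $ 1) (int p)" "coprime (\<gamma> $ 2 $ 2) (int p)"
    by auto
qed

lemma Gamma0_mult_closed:
  assumes "\<gamma> \<in> carrier (Gamma0 p)" "\<gamma>' \<in> carrier (Gamma0 p)"
  shows "\<gamma> ** \<gamma>' \<in> carrier (Gamma0 p)"
  using assms by (auto simp: Gamma0_def det_mul cong_0_iff int_matrix_mult_2)

lemma Gamma0_uminus_closed: "\<gamma> \<in> carrier (Gamma0 p) \<Longrightarrow> - \<gamma> \<in> carrier (Gamma0 p)"
  by (simp add: Gamma0_mem_iff)

lemma Gamma0_exists:
  assumes "coprime v (int p)"
  obtains \<gamma> where "\<gamma> \<in> carrier (Gamma0 p)" "\<gamma> $ 1 $ 1 = v"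
proof -
  obtain w where "[v * w = 1] (mod int p)"
    using assms by (rule inverse_mod_prime)
  then obtain k where "v * w - 1 = int p * k"
    by (auto simp: cong_iff_dvd_diff)
  then show thesis
    \<comment> \<open>The matrix with rows (v, k) and (p, w) has determinant v w - p k = 1.\<close>
    by (intro that[of "vector [vector [v, k], vector [int p, w]]"]) (auto simp: Gamma0_mem_iff vector_2 algebra_simps)
qed

lemma carrier_PGamma0: "carrier (PGamma0 p) = (\<lambda>\<gamma>. pm_I #>\<^bsub>Gamma0 p\<^esub> \<gamma>) ` carrier (Gamma0 p)"
  by (auto simp: PGamma0_def FactGroup_def RCOSETS_def)

lemma mult_PGamma0:
  "(pm_I #>\<^bsub>Gamma0 p\<^esub> \<gamma>) \<otimes>\<^bsub>PGamma0 p\<^esub> (pm_I #>\<^bsub>Gamma0 p\<^esub> \<gamma>') = pm_I #>\<^bsub>Gamma0 p\<^esub> (\<gamma> ** \<gamma>')"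
proof -
  have "(- \<gamma>) ** \<gamma>' = - (\<gamma> ** \<gamma>')" "\<gamma> ** (- \<gamma>') = - (\<gamma> ** \<gamma>')" "(- \<gamma>) ** (- \<gamma>') = \<gamma> ** \<gamma>'"
    by (simp_all add: vec_eq_iff int_matrix_mult_2)
  then show ?thesis
    unfolding pm_I_coset by (simp add: PGamma0_def FactGroup_def set_mult_def Gamma0_def insert_commute)
qed

section \<open>The action on a family indexed by units\<close>

lemma diamond_mono_eq_upto_sign:
  assumes "\<gamma> \<in> carrier (Gamma0 p)" "eq_upto_sign f g"
  shows "eq_upto_sign (diamond k \<gamma> f) (diamond k \<gamma> g)"
proof -
  have "moebius \<gamma> \<tau> \<in> upper_half_plane" if "\<tau> \<in> upper_half_plane" for \<tau>
    using that assms(1) Im_moebius_pos(2)[of \<tau> "\<gamma> $ 1 $ 1" "\<gamma> $ 2 $ 2" "\<gamma> $ 1 $ 2" "\<gamma> $ 2 $ 1"]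
    by (simp add: upper_half_plane_def moebius_def Gamma0_mem_iff)
  then show ?thesis
    using assms(2) by (auto simp: eq_upto_sign_def diamond_def)
qed

text \<open>Here \<open>K v\<close> extends the family from the labels \<open>u i\<close> to all
  integers, so that the action becomes multiplication on the parameter. The isolation of the first
  function in \<open>xfun_1\<close> is the sole source of distinctness; freeness of the action is
  derived from it.\<close>

locale diamond_family =
  fixes p :: nat and K :: "int \<Rightarrow> complex \<Rightarrow> complex" and u :: "nat \<Rightarrow> nat"
  assumes prime_p: "prime p" and p_gt_2: "p > 2"
    and K_cong: "cong_pm p v w \<Longrightarrow> eq_upto_sign (K v) (K w)"
    and diamond_K: "\<gamma> \<in> carrier (Gamma0 p) \<Longrightarrow> eq_upto_sign (diamond 1 \<gamma> (K v)) (K (\<gamma> $ 1 $ 1 * v))"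
    and xfun_K: "i \<in> {1..(p - 1) div 2} \<Longrightarrow> eq_upto_sign (xfun p i) (K (int (u i)))"
    and u_bij: "bij_betw u {1..(p - 1) div 2} {1..(p - 1) div 2}"
    and u_1: "u 1 = 1"
    and xfun_1: "i \<in> {1..(p - 1) div 2} \<Longrightarrow> eq_upto_sign (xfun p i) (xfun p 1) \<Longrightarrow> i = 1"
begin

abbreviation idx :: "nat set" where "idx \<equiv> {1..(p - 1) div 2}"

lemma one_in_idx: "1 \<in> idx"
  using p_gt_2 by auto

lemma unique_index:
  assumes "coprime v (int p)"
  shows "\<exists>!i. i \<in> idx \<and> cong_pm p v (int (u i))"
proof -
  obtain r where r: "r \<in> idx" "cong_pm p v (int r)"
    and uniq: "\<And>s. s \<in> idx \<Longrightarrow> cong_pm p v (int s) \<Longrightarrow> s = r"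
    using unique_representative_mod_pm[OF prime_p p_gt_2 assms] by blast
  obtain i where "i \<in> idx" "u i = r"
    using r(1) u_bij by (metis bij_betw_imp_surj_on imageE)
  moreover have "j = i" if "j \<in> idx" "cong_pm p v (int (u j))" for j
  proof -
    have "u j = r"
      using uniq[of "u j"] that u_bij by (metis bij_betwE)
    then show ?thesis
      using \<open>i \<in> idx\<close> \<open>u i = r\<close> that u_bij by (metis bij_betw_imp_inj_on inj_onD)
  qed
  ultimately show ?thesis
    using r(2) by blast
qed

lemma coprime_u:
  assumes "i \<in> idx"
  shows "coprime (int (u i)) (int p)"
proof -
  have "u i \<in> idx"
    using assms u_bij by (metis bij_betwE)
  then have "\<not> p dvd u i"
    using p_gt_2 by (auto dest!: dvd_imp_le)
  then show ?thesis
    using prime_p by (simp add: prime_imp_coprime coprime_commute)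
qed

lemma u_cong_imp_eq:
  assumes "i \<in> idx" "j \<in> idx" "cong_pm p (int (u i)) (int (u j))"
  shows "i = j"
  using unique_index[OF coprime_u[OF assms(1)]] assms cong_pm_refl by blast

text \<open>A matrix whose upper left entry inverts \<open>w\<close> modulo \<open>p\<close> carries
  \<open>K w\<close> to the first function and \<open>K v\<close> to some function with index
  \<open>k\<close>, up to sign. Equality up to sign is preserved, so \<open>xfun_1\<close> forces
  \<open>k = 1\<close>, and the inverse of \<open>w\<close> is cancelled from the resulting
  congruence.\<close>

lemma K_eq_iff:
  assumes v: "coprime v (int p)" and w: "coprime w (int p)"
  shows "eq_upto_sign (K v) (K w) \<longleftrightarrow> cong_pm p v w"
proof
  assume eq: "eq_upto_sign (K v) (K w)"
  obtain w' where w': "[w * w' = 1] (mod int p)" "coprime w' (int p)"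
    using w by (rule inverse_mod_prime)
  obtain \<gamma> where \<gamma>: "\<gamma> \<in> carrier (Gamma0 p)" "\<gamma> $ 1 $ 1 = w'"
    using w'(2) by (rule Gamma0_exists)
  have "coprime (w' * v) (int p)"
    using v w' by simp
  then obtain k where k: "k \<in> idx" "cong_pm p (w' * v) (int (u k))"
    using unique_index by blast
  have w'w: "cong_pm p (w' * w) (int (u 1))"
    unfolding u_1 using w'(1) by (simp add: mult.commute cong_imp_cong_pm)
  have "eq_upto_sign (xfun p k) (K (int (u k)))"
    using k(1) by (rule xfun_K)
  also have "eq_upto_sign \<dots> (K (w' * v))"
    using K_cong[OF k(2)] by (rule eq_upto_sign_sym)
  also have "eq_upto_sign \<dots> (diamond 1 \<gamma> (K v))"
    using diamond_K[OF \<gamma>(1), of v] by (simp add: \<gamma>(2) eq_upto_sign_sym)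
  also have "eq_upto_sign \<dots> (diamond 1 \<gamma> (K w))"
    using \<gamma>(1) eq by (rule diamond_mono_eq_upto_sign)
  also have "eq_upto_sign \<dots> (K (w' * w))"
    using diamond_K[OF \<gamma>(1), of w] by (simp add: \<gamma>(2))
  also have "eq_upto_sign \<dots> (K (int (u 1)))"
    using w'w by (rule K_cong)
  also have "eq_upto_sign \<dots> (xfun p 1)"
    using xfun_K[OF one_in_idx] by (rule eq_upto_sign_sym)
  finally have k1: "k = 1"
    by (rule xfun_1[OF k(1)])
  have "cong_pm p (w' * v) (w' * w)"
    by (rule cong_pm_trans[OF prime_p k(2)[unfolded k1] cong_pm_sym[OF prime_p w'w]])
  then show "cong_pm p v w"
    using cong_pm_cancel_unit[OF prime_p, of w' w v w] w'(1) by (simp add: mult.commute)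
qed (rule K_cong)

lemma diamond_xfun_iff:
  assumes \<gamma>: "\<gamma> \<in> carrier (Gamma0 p)" and i: "i \<in> idx" and j: "j \<in> idx"
  shows "eq_upto_sign (diamond 1 \<gamma> (xfun p i)) (xfun p j) \<longleftrightarrow> cong_pm p (\<gamma> $ 1 $ 1 * int (u i)) (int (u j))"
proof -
  have 1: "eq_upto_sign (diamond 1 \<gamma> (xfun p i)) (K (\<gamma> $ 1 $ 1 * int (u i)))"
    using diamond_mono_eq_upto_sign[OF \<gamma> xfun_K[OF i]] diamond_K[OF \<gamma>] by (rule eq_upto_sign_trans)
  have "eq_upto_sign (diamond 1 \<gamma> (xfun p i)) (xfun p j) \<longleftrightarrow>
      eq_upto_sign (K (\<gamma> $ 1 $ 1 * int (u i))) (K (int (u j)))"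
    using 1 xfun_K[OF j] eq_upto_sign_sym eq_upto_sign_trans by blast
  also have "\<dots> \<longleftrightarrow> cong_pm p (\<gamma> $ 1 $ 1 * int (u i)) (int (u j))"
    using Gamma0_diag(2)[OF \<gamma>] coprime_u[OF i] coprime_u[OF j] by (intro K_eq_iff) auto
  finally show ?thesis .
qed

section \<open>Multiplication by a unit as a permutation of the indices\<close>

definition shift :: "int \<Rightarrow> nat \<Rightarrow> nat" where
  "shift v i = (if i \<in> idx then THE j. j \<in> idx \<and> cong_pm p (v * int (u i)) (int (u j)) else i)"

lemma shift_outside: "i \<notin> idx \<Longrightarrow> shift v i = i"
  unfolding shift_def by (rule if_not_P)

lemma shift_props:
  assumes "coprime v (int p)" "i \<in> idx"
  shows "shift v i \<in> idx" "cong_pm p (v * int (u i)) (int (u (shift v i)))"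
proof -
  have "\<exists>!j. j \<in> idx \<and> cong_pm p (v * int (u i)) (int (u j))"
    by (rule unique_index) (use assms coprime_u in auto)
  from theI'[OF this] assms(2) show "shift v i \<in> idx" "cong_pm p (v * int (u i)) (int (u (shift v i)))"
    by (auto simp: shift_def)
qed

lemma shift_eqI:
  assumes v: "coprime v (int p)" and "i \<in> idx" "j \<in> idx" and "cong_pm p (v * int (u i)) (int (u j))"
  shows "shift v i = j"
  using shift_props[OF v \<open>i \<in> idx\<close>] assms u_cong_imp_eq cong_pm_sym[OF prime_p] cong_pm_trans[OF prime_p] by blast

lemma shift_mult:
  assumes v: "coprime v (int p)" and w: "coprime w (int p)"
  shows "shift (v * w) = shift v \<circ> shift w"
proof
  fix i
  show "shift (v * w) i = (shift v \<circ> shift w) i"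
  proof (cases "i \<in> idx")
    case True
    note 1 = shift_props[OF w True]
    note 2 = shift_props[OF v 1(1)]
    have "cong_pm p (v * (w * int (u i))) (v * int (u (shift w i)))"
      using 1(2) by (intro cong_pm_mult prime_p) simp
    then have "cong_pm p (v * w * int (u i)) (int (u (shift v (shift w i))))"
      using 2(2) cong_pm_trans[OF prime_p] by (metis mult.assoc)
    then have "shift (v * w) i = shift v (shift w i)"
      using v w True 2(1) by (intro shift_eqI) auto
    then show ?thesis
      by simp
  next
    case False
    then show ?thesis by (simp only: shift_outside[OF False] o_apply)
  qed
qed

lemma shift_cong:
  assumes "cong_pm p v w"
  shows "shift v = shift w"
proof -
  have "cong_pm p (v * int (u i)) (int (u j)) \<longleftrightarrow> cong_pm p (w * int (u i)) (int (u j))" for i j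
    using cong_pm_mult[OF prime_p assms cong_pm_refl[of p "int (u i)"]] cong_pm_sym[OF prime_p] cong_pm_trans[OF prime_p]
    by blast
  then show ?thesis
    by (simp add: shift_def fun_eq_iff)
qed

lemma shift_1: "shift 1 = id"
proof
  fix i
  show "shift 1 i = id i"
  proof (cases "i \<in> idx")
    case True
    then have "shift 1 i = i"
      by (intro shift_eqI) simp_all
    then show ?thesis by simp
  next
    case False
    then show ?thesis by (simp only: shift_outside[OF False] id_apply)
  qed
qed

lemma shift_permutes:
  assumes v: "coprime v (int p)"
  shows "shift v permutes idx"
proof -
  obtain w where w: "[v * w = 1] (mod int p)" "coprime w (int p)"
    using v by (rule inverse_mod_prime)
  have "shift (v * w) = id" "shift (w * v) = id"
    using shift_cong[OF cong_imp_cong_pm[OF w(1)]] shift_1 by (simp_all add: mult.commute)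
  then have "shift v \<circ> shift w = id" "shift w \<circ> shift v = id"
    using v w(2) by (simp_all add: shift_mult)
  then have "bij (shift v)"
    using o_bij by blast
  then show ?thesis
    by (simp add: permutes_def bij_iff shift_outside del: atLeastAtMost_iff)
qed

text \<open>The two matrices in the class have opposite upper left entries, and
  \<open>cong_pm\<close> ignores the sign; hence both impose the same condition on \<open>j\<close>,
  and the two definite descriptions coincide.\<close>

lemma perm_rep_eq_shift:
  assumes \<gamma>: "\<gamma> \<in> carrier (Gamma0 p)"
  shows "perm_rep p (pm_I #>\<^bsub>Gamma0 p\<^esub> \<gamma>) = shift (\<gamma> $ 1 $ 1)"
proof
  fix i
  show "perm_rep p (pm_I #>\<^bsub>Gamma0 p\<^esub> \<gamma>) i = shift (\<gamma> $ 1 $ 1) i"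
  proof (cases "i \<in> idx")
    case True
    have "j \<in> idx \<and> (\<forall>\<gamma>'\<in>pm_I #>\<^bsub>Gamma0 p\<^esub> \<gamma>. eq_upto_sign (diamond 1 \<gamma>' (xfun p i)) (xfun p j)) \<longleftrightarrow>
        j \<in> idx \<and> cong_pm p (\<gamma> $ 1 $ 1 * int (u i)) (int (u j))" for j
      using diamond_xfun_iff[OF \<gamma> True, of j] diamond_xfun_iff[OF Gamma0_uminus_closed[OF \<gamma>] True, of j]
      by (auto simp: pm_I_coset)
    with True show ?thesis
      by (simp add: perm_rep_def shift_def)
  next
    case False
    then show ?thesis unfolding perm_rep_def shift_def by (simp only: if_False)
  qed
qed

section \<open>The permutation representation and its identification with the unit group\<close>

lemma diamond_permutes:
  "\<forall>\<gamma>\<in>carrier (Gamma0 p). \<forall>i\<in>idx. \<exists>j\<in>idx. eq_upto_sign (diamond 1 \<gamma> (xfun p i)) (xfun p j)"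
  using diamond_xfun_iff shift_props Gamma0_diag(2) by blast

lemma perm_rep_hom: "perm_rep p \<in> hom (PGamma0 p) (sym_group ((p - 1) div 2))"
proof (rule homI)
  fix C
  assume "C \<in> carrier (PGamma0 p)"
  then show "perm_rep p C \<in> carrier (sym_group ((p - 1) div 2))"
    using shift_permutes Gamma0_diag(2) by (auto simp: carrier_PGamma0 perm_rep_eq_shift sym_group_carrier)
next
  fix C D
  assume "C \<in> carrier (PGamma0 p)" "D \<in> carrier (PGamma0 p)"
  then obtain \<gamma> \<delta> where \<gamma>: "\<gamma> \<in> carrier (Gamma0 p)" "C = pm_I #>\<^bsub>Gamma0 p\<^esub> \<gamma>"
    and \<delta>: "\<delta> \<in> carrier (Gamma0 p)" "D = pm_I #>\<^bsub>Gamma0 p\<^esub> \<delta>"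
    by (auto simp: carrier_PGamma0)
  \<comment> \<open>The other summand of the upper left entry contains the lower left entry of
    \<delta>, a multiple of \<open>p\<close>. Commutativity of the units makes the order of
    composition immaterial.\<close>
  have "[(\<gamma> ** \<delta>) $ 1 $ 1 = \<gamma> $ 1 $ 1 * \<delta> $ 1 $ 1] (mod int p)"
    using \<delta>(1) by (simp add: int_matrix_mult_2 Gamma0_mem_iff cong_iff_dvd_diff)
  then show "perm_rep p (C \<otimes>\<^bsub>PGamma0 p\<^esub> D) =
      perm_rep p C \<otimes>\<^bsub>sym_group ((p - 1) div 2)\<^esub> perm_rep p D"
    using \<gamma> \<delta> Gamma0_diag(2)
    by (simp add: mult_PGamma0 perm_rep_eq_shift Gamma0_mult_closed sym_group_mult
        shift_cong[OF cong_imp_cong_pm] shift_mult)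
qed

lemma perm_rep_image: "perm_rep p ` carrier (PGamma0 p) = {shift v | v. coprime v (int p)}"
proof -
  have "perm_rep p ` carrier (PGamma0 p) = (\<lambda>\<gamma>. shift (\<gamma> $ 1 $ 1)) ` carrier (Gamma0 p)"
    by (auto simp: carrier_PGamma0 image_image perm_rep_eq_shift intro!: rev_image_eqI)
  also have "\<dots> = {shift v | v. coprime v (int p)}"
    using Gamma0_diag(2) by (auto elim!: Gamma0_exists intro!: image_eqI)
  finally show ?thesis .
qed

lemma perm_rep_image_iso:
  "(sym_group ((p - 1) div 2))\<lparr>carrier := perm_rep p ` carrier (PGamma0 p)\<rparr> \<cong> units_mod_pm p"
proof -
  \<comment> \<open>A permutation in the image is recovered from its value at 1: as
    \<open>u 1 = 1\<close>, the label of \<open>shift v 1\<close> is \<open>v\<close> up to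
    sign.\<close>
  define h where "h = (\<lambda>\<sigma>. unit_class p (int (u (\<sigma> (1 :: nat)))))"
  have h: "h (shift v) = unit_class p v" if "coprime v (int p)" for v
    using cong_pm_sym[OF prime_p shift_props(2)[OF that one_in_idx]] unfolding h_def unit_class_eq_iff u_1 by simp
  have "h \<in> hom ((sym_group ((p - 1) div 2))\<lparr>carrier := perm_rep p ` carrier (PGamma0 p)\<rparr>) (units_mod_pm p)"
    by (rule homI)
      (auto simp: perm_rep_image h carrier_units_mod_pm[OF prime_p] sym_group_mult mult_units_mod_pm simp flip: shift_mult)
  moreover have "bij_betw h (perm_rep p ` carrier (PGamma0 p)) (carrier (units_mod_pm p))"
    unfolding bij_betw_def
  proof
    show "inj_on h (perm_rep p ` carrier (PGamma0 p))"
      by (rule inj_onI) (auto simp: perm_rep_image h unit_class_eq_iff intro: shift_cong)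
    show "h ` (perm_rep p ` carrier (PGamma0 p)) = carrier (units_mod_pm p)"
      unfolding perm_rep_image carrier_units_mod_pm[OF prime_p] setcompr_eq_image
      by (simp add: image_image h cong: image_cong_simp)
  qed
  ultimately show ?thesis
    by (auto simp: is_iso_def iso_def)
qed

text \<open>The action multiplies labels by the upper left entry, which is inverse to the lower
  right entry modulo \<open>p\<close>. Sending an index to the class of the inverse of its label
  therefore turns the action into translation by the class of the lower right entry, the regular
  representation.\<close>

lemma perm_rep_regular:
  "\<exists>\<phi>. bij_betw \<phi> idx (carrier (units_mod_pm p)) \<and>
     (\<forall>\<gamma>\<in>carrier (Gamma0 p). \<forall>i\<in>idx.
        \<phi> (perm_rep p (pm_I #>\<^bsub>Gamma0 p\<^esub> \<gamma>) i) = unit_class p (\<gamma> $ 2 $ 2) \<otimes>\<^bsub>units_mod_pm p\<^esub> \<phi> i)"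
proof -
  have "\<exists>w. [int (u i) * w = 1] (mod int p) \<and> coprime w (int p)" if "i \<in> idx" for i
    using inverse_mod_prime[OF coprime_u[OF that]] by blast
  then obtain w where w: "\<And>i. i \<in> idx \<Longrightarrow> [int (u i) * w i = 1] (mod int p)"
    and cop: "\<And>i. i \<in> idx \<Longrightarrow> coprime (w i) (int p)"
    by metis
  \<comment> \<open>Inverses modulo \<open>p\<close> and sign are unique.\<close>
  have inverse_pm: "cong_pm p a b" if "cong_pm p (a * c) 1" "cong_pm p (b * c) 1" "coprime c (int p)" for a b c
  proof -
    obtain c' where "[c * c' = 1] (mod int p)"
      using \<open>coprime c (int p)\<close> by (rule inverse_mod_prime)
    moreover have "cong_pm p (a * c) (b * c)"
      using that cong_pm_sym[OF prime_p] cong_pm_trans[OF prime_p] by blast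
    ultimately show ?thesis
      by (rule cong_pm_cancel_unit[OF prime_p])
  qed
  have wu: "cong_pm p (w i * int (u i)) 1" "cong_pm p (int (u i) * w i) 1" if "i \<in> idx" for i
    using w[OF that] by (simp_all add: cong_imp_cong_pm mult.commute)
  define \<phi> where "\<phi> = (\<lambda>i. unit_class p (w i))"
  have "inj_on \<phi> idx"
  proof (rule inj_onI)
    fix i j
    assume i: "i \<in> idx" and j: "j \<in> idx" and "\<phi> i = \<phi> j"
    then have "cong_pm p (w i) (w j)"
      by (simp add: \<phi>_def unit_class_eq_iff)
    then have "cong_pm p (int (u j) * w i) (int (u j) * w j)"
      by (intro cong_pm_mult prime_p) simp
    then have "cong_pm p (int (u i)) (int (u j))"
      using inverse_pm[OF wu(2)[OF i] cong_pm_trans[OF prime_p _ wu(2)[OF j]] cop[OF i]] by blast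
    with i j show "i = j"
      by (rule u_cong_imp_eq)
  qed
  moreover have "\<phi> ` idx = carrier (units_mod_pm p)"
    unfolding carrier_units_mod_pm[OF prime_p]
  proof safe
    fix i
    assume "i \<in> idx"
    then show "\<exists>d. \<phi> i = unit_class p d \<and> coprime d (int p)"
      using cop by (auto simp: \<phi>_def)
  next
    fix d
    assume "coprime d (int p)"
    then obtain e where e: "[d * e = 1] (mod int p)" "coprime e (int p)"
      by (rule inverse_mod_prime)
    obtain i where i: "i \<in> idx" "cong_pm p e (int (u i))"
      using unique_index[OF e(2)] by blast
    have "cong_pm p (d * int (u i)) (d * e)"
      using cong_pm_sym[OF prime_p i(2)] by (intro cong_pm_mult prime_p) simp
    then have "cong_pm p (d * int (u i)) 1"
      using cong_imp_cong_pm[OF e(1)] by (rule cong_pm_trans[OF prime_p])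
    then have "cong_pm p d (w i)"
      using wu(1)[OF i(1)] coprime_u[OF i(1)] by (rule inverse_pm)
    then show "unit_class p d \<in> \<phi> ` idx"
      using i(1) by (auto simp: \<phi>_def unit_class_eq_iff)
  qed
  moreover have "\<phi> (perm_rep p (pm_I #>\<^bsub>Gamma0 p\<^esub> \<gamma>) i) = unit_class p (\<gamma> $ 2 $ 2) \<otimes>\<^bsub>units_mod_pm p\<^esub> \<phi> i"
    if \<gamma>: "\<gamma> \<in> carrier (Gamma0 p)" and i: "i \<in> idx" for \<gamma> i
  proof -
    define j where "j = shift (\<gamma> $ 1 $ 1) i"
    note diag = Gamma0_diag[OF \<gamma>]
    have j: "j \<in> idx" "cong_pm p (\<gamma> $ 1 $ 1 * int (u i)) (int (u j))"
      using shift_props[OF diag(2) i] by (simp_all add: j_def)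
    \<comment> \<open>The right-hand side is a product of two pairs of mutually inverse residues. So
      \<gamma>_22 w_i is an inverse of the label of \<open>j\<close> up to sign, as
      \<open>w j\<close> is.\<close>
    have "cong_pm p (\<gamma> $ 2 $ 2 * w i * int (u j)) (\<gamma> $ 2 $ 2 * w i * (\<gamma> $ 1 $ 1 * int (u i)))"
      by (rule cong_pm_mult[OF prime_p cong_pm_refl cong_pm_sym[OF prime_p j(2)]])
    also have "\<gamma> $ 2 $ 2 * w i * (\<gamma> $ 1 $ 1 * int (u i)) = (\<gamma> $ 1 $ 1 * \<gamma> $ 2 $ 2) * (w i * int (u i))"
      by (simp add: mult_ac)
    finally have "cong_pm p (\<gamma> $ 2 $ 2 * w i * int (u j)) ((\<gamma> $ 1 $ 1 * \<gamma> $ 2 $ 2) * (w i * int (u i)))" .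
    moreover have "cong_pm p ((\<gamma> $ 1 $ 1 * \<gamma> $ 2 $ 2) * (w i * int (u i))) 1"
      using cong_pm_mult[OF prime_p cong_imp_cong_pm[OF diag(1)] wu(1)[OF i]] by simp
    ultimately have "cong_pm p (\<gamma> $ 2 $ 2 * w i * int (u j)) 1"
      by (rule cong_pm_trans[OF prime_p])
    with wu(1)[OF j(1)] have "cong_pm p (w j) (\<gamma> $ 2 $ 2 * w i)"
      using coprime_u[OF j(1)] by (rule inverse_pm)
    then show ?thesis
      by (simp add: \<phi>_def perm_rep_eq_shift[OF \<gamma>] mult_units_mod_pm unit_class_eq_iff flip: j_def)
  qed
  ultimately show ?thesis
    unfolding bij_betw_def by blast
qed

end

text \<open>The isomorphism is expressed both for the group of induced permutations and for the
  action itself, which is identified with translation on the quotient group; the second form records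
  the transitivity and freeness of the action.\<close>

theorem theorem1p2:
  fixes p :: nat
  assumes "prime p" and "5 \<le> p" and "p \<le> 19"
  shows
    "(\<forall>\<gamma>\<in>carrier (Gamma0 p). \<forall>i\<in>{1..(p - 1) div 2}. \<exists>j\<in>{1..(p - 1) div 2}.
        eq_upto_sign (diamond 1 \<gamma> (xfun p i)) (xfun p j)) \<and>
     perm_rep p \<in> hom (PGamma0 p) (sym_group ((p - 1) div 2)) \<and>
     (sym_group ((p - 1) div 2))\<lparr>carrier := perm_rep p ` carrier (PGamma0 p)\<rparr> \<cong> units_mod_pm p \<and>
     (\<exists>\<phi>. bij_betw \<phi> {1..(p - 1) div 2} (carrier (units_mod_pm p)) \<and>
        (\<forall>\<gamma>\<in>carrier (Gamma0 p). \<forall>i\<in>{1..(p - 1) div 2}.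
           \<phi> (perm_rep p (pm_I #>\<^bsub>Gamma0 p\<^esub> \<gamma>) i) =
             unit_class p (\<gamma> $ 2 $ 2) \<otimes>\<^bsub>units_mod_pm p\<^esub> \<phi> i))"
proof -
  have "\<forall>n\<in>{5..19 :: nat}. prime n \<longrightarrow> n \<in> {5, 7, 11, 13, 17, 19}"
    by code_simp
  then have p: "p \<in> {5, 7, 11, 13, 17, 19}"
    using assms by auto
  obtain ds ns u where len: "length ds = Suc (length ns)"
    and sq: "int p dvd (\<Sum>g\<leftarrow>ns. g\<^sup>2) - (\<Sum>g\<leftarrow>ds. g\<^sup>2)"
    and u: "bij_betw u {1..(p - 1) div 2} {1..(p - 1) div 2}" "u 1 = 1"
    and x: "\<forall>i\<in>{1..(p - 1) div 2}.
       eq_upto_sign (xfun p i) (kprod p (map ((*) (int (u i))) ns) (map ((*) (int (u i))) ds))"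
    and x1: "\<forall>i\<in>{1..(p - 1) div 2}. eq_upto_sign (xfun p i) (xfun p 1) \<longrightarrow> i = 1"
    by (rule level_family[OF p])
  \<comment> \<open>The index lists of the first function, scaled by an arbitrary integer instead of
    only by the labels.\<close>
  define K where "K v = kprod p (map ((*) v) ns) (map ((*) v) ds)" for v
  have p0: "p > 0"
    using assms(2) by simp
  interpret diamond_family p K u
  proof
    show "prime p" "p > 2"
      using assms by simp_all
    show "eq_upto_sign (K v) (K w)" if "cong_pm p v w" for v w
    proof -
      have "cong_pm p (v * g) (w * g)" for g
        using assms(1) that by (rule cong_pm_mult) simp
      then show ?thesis
        unfolding K_def by (intro kprod_cong_pm p0) (simp_all add: list_all2_conv_all_nth)
    qed
    show "eq_upto_sign (diamond 1 \<gamma> (K v)) (K (\<gamma> $ 1 $ 1 * v))" if "\<gamma> \<in> carrier (Gamma0 p)" for \<gamma> v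
    proof -
      \<comment> \<open>Scaling multiplies the signed sum of squares by v^2, so divisibility by
        \<open>p\<close> holds for every member of the family.\<close>
      have "(\<Sum>g\<leftarrow>map ((*) v) gs. g\<^sup>2) = v\<^sup>2 * (\<Sum>g\<leftarrow>gs. g\<^sup>2)" for gs :: "int list"
        by (simp add: o_def power_mult_distrib sum_list_const_mult)
      then have "int p dvd (\<Sum>g\<leftarrow>map ((*) v) ns. g\<^sup>2) - (\<Sum>g\<leftarrow>map ((*) v) ds. g\<^sup>2)"
        using sq by (simp only: right_diff_distrib[symmetric] dvd_mult)
      moreover have "map ((*) (\<gamma> $ 1 $ 1 * v)) gs = map ((*) (\<gamma> $ 1 $ 1)) (map ((*) v) gs)" for gs
        by (simp add: mult.assoc)
      ultimately show ?thesis
        unfolding K_def using p0 that len by (simp only:) (intro diamond_kprod; simp)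
    qed
    show "eq_upto_sign (xfun p i) (K (int (u i)))" if "i \<in> {1..(p - 1) div 2}" for i
      using x that by (simp add: K_def)
  qed (use u x1 in blast)+
  show ?thesis
    by (intro conjI diamond_permutes perm_rep_hom perm_rep_image_iso perm_rep_regular)
qed

end
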